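(* Let $0<\rho<1$ be a non-dyadic number and let $d$ be a positive integer. Then there is a constant $c_{d,\rho}>0$, depending only on $d$ and $\rho$, such that for every $n$ and every polynomial $P\colon\mathbb{F}_2^n\to\mathbb{F}_2$ of degree at most $d$, the distribution of $P(X)$ for $X$ uniform on $\mathbb{F}_2^n$ satisfies $\|P(X)-\mathrm{Ber}(\rho)\|_{\mathtt{TV}}\ge c_{d,\rho}$.
   Context: A dyadic number is one of the form $a/2^b$ with $a\in\mathbb{Z}$, $b\in\mathbb{N}$. Total variation distance: $\frac12\sum_x|\mathcal{D}_1(x)-\mathcal{D}_2(x)|$. *)

theory Defs
  imports Complex_Main
begin

definition dyadic :: "real \<Rightarrow> bool" where
  "dyadic r \<longleftrightarrow> (\<exists>(a::int) (b::nat). r = of_int a / 2 ^ b)"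

text \<open>The cube F_2^n, with F_2 represented by bool (True = 1), points as bool lists of length n.\<close>
definition cube :: "nat \<Rightarrow> bool list set" where
  "cube n = {xs. length xs = n}"

text \<open>P : F_2^n -> F_2 is a polynomial of degree at most d: on the cube it agrees with
  a sum over F_2 (i.e. parity) of monomials prod_{i in S} x_i with |S| <= d, with coefficients c S.
  (Since x_i^2 = x_i on F_2, multilinear monomials suffice.)\<close>
definition poly_deg_le :: "nat \<Rightarrow> nat \<Rightarrow> (bool list \<Rightarrow> bool) \<Rightarrow> bool" where
  "poly_deg_le n d P \<longleftrightarrow>
     (\<exists>c :: nat set \<Rightarrow> bool. \<forall>x\<in>cube n.
        P x = odd (card {S. S \<subseteq> {..<n} \<and> card S \<le> d \<and> c S \<and> (\<forall>i\<in>S. x ! i)}))"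

definition prob_one :: "nat \<Rightarrow> (bool list \<Rightarrow> bool) \<Rightarrow> real" where
  "prob_one n P = real (card {x\<in>cube n. P x}) / 2 ^ n"

definition tv_ber :: "nat \<Rightarrow> (bool list \<Rightarrow> bool) \<Rightarrow> real \<Rightarrow> real" where
  "tv_ber n P \<rho> = (1/2) * (\<bar>prob_one n P - \<rho>\<bar> + \<bar>(1 - prob_one n P) - (1 - \<rho>)\<bar>)"

end

(*
  Write f = (-1)^P, a sign-valued function all of whose (d+1)-fold multiplicative derivatives are 1.
  The key fact is the bias-rank theorem of Kaufman and Lovett: if |E f| >= eps, then f(x) is a
  function of boundedly many derivatives f(x+a) f(x).  Sampling random a gives a function F of
  derivatives that approximates f on average; since f(x) is the product of f over the other vertices
  of every cube at x, replacing f by F there and averaging over the cube gives an approximation at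
  every x.  It remains to see that such cube averages of lower degree phases are determined by
  boundedly many shifts of these phases.  By the Gowers-Cauchy-Schwarz inequality, either the average
  is uniformly small or the cube phase of a phase at a maximal vertex is biased; in the latter case the
  theorem in smaller degree rewrites that phase through its derivatives and the phases at smaller
  vertices.

  Hence a function of m phases either has all nontrivial products of the phases nearly unbiased, and
  then its mean is close to a multiple of 2^-m, or some phase can be traded for boundedly many phases
  of smaller degree.  The multiset of degrees decreases, so this stops after boundedly many steps, and
  a non-dyadic number keeps a positive distance throughout.
*)

theory Submission
  imports Defs "HOL-Library.Function_Algebras" "HOL-Library.Z2" "HOL-Library.Multiset"
    "HOL-Library.FuncSet" "HOL-Library.Nat_Bijection"
begin

section \<open>Averages over finite groups\<close>

text \<open>An approximation in the mean would not suffice when a biased phase is traded away: the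
  0/1 function has to remain an exact function of the new list of phases. In a cube based at x every
  other vertex is uniformly distributed, so the mean error bounds the error at each x, and two signs
  that differ by less than 2 are equal. The price is an average over unboundedly many cubes, to be
  controlled by boundedly many shifts. The induction on the degree closes because these cubes carry
  derivatives of f: the theorem is needed only in lower degree, but on powers of the group.

  In the final argument "nearly unbiased" must be small against 2^-m, while trading a phase raises
  m. No single threshold serves all stages, so a new one is fixed for each multiset of degrees, and
  the constants come from well-founded recursion on multisets; they do not depend on the group or
  the function.\<close>

definition fin_subgroup :: "'a::ab_group_add set \<Rightarrow> bool" where
  "fin_subgroup V \<longleftrightarrow> finite V \<and> 0 \<in> V \<and> (\<forall>x\<in>V. \<forall>y\<in>V. x + y \<in> V) \<and> (\<forall>x\<in>V. - x \<in> V)"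

definition avg :: "'a set \<Rightarrow> ('a \<Rightarrow> real) \<Rightarrow> real" where
  "avg V f = (\<Sum>x\<in>V. f x) / real (card V)"

lemma fin_subgroupD:
  assumes "fin_subgroup V"
  shows "finite V" "0 \<in> V" "x \<in> V \<Longrightarrow> y \<in> V \<Longrightarrow> x + y \<in> V" "x \<in> V \<Longrightarrow> - x \<in> V"
    "x \<in> V \<Longrightarrow> y \<in> V \<Longrightarrow> x - y \<in> V" "card V > 0"
proof -
  show "finite V" "0 \<in> V" "x \<in> V \<Longrightarrow> y \<in> V \<Longrightarrow> x + y \<in> V" "x \<in> V \<Longrightarrow> - x \<in> V"
    using assms by (auto simp: fin_subgroup_def)
  show "x \<in> V \<Longrightarrow> y \<in> V \<Longrightarrow> x - y \<in> V"
    using assms unfolding fin_subgroup_def by (metis add_uminus_conv_diff)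
  show "card V > 0"
    using assms by (auto simp: fin_subgroup_def card_gt_0_iff)
qed

lemma fin_subgroup_sum:
  assumes "fin_subgroup V" "\<And>j. j \<in> J \<Longrightarrow> h j \<in> V"
  shows "(\<Sum>j\<in>J. h j) \<in> V"
  using assms(2) by (induction J rule: infinite_finite_induct) (auto simp: fin_subgroupD[OF assms(1)])

lemma avg_cong: "(\<And>x. x \<in> V \<Longrightarrow> f x = g x) \<Longrightarrow> avg V f = avg V g"
  by (auto simp: avg_def intro!: sum.cong)

lemma avg_const: "fin_subgroup V \<Longrightarrow> avg V (\<lambda>x. c) = c"
  using fin_subgroupD(6)[of V] by (simp add: avg_def)

lemma avg_mono: "(\<And>x. x \<in> V \<Longrightarrow> f x \<le> g x) \<Longrightarrow> avg V f \<le> avg V g"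
  by (auto simp: avg_def intro!: divide_right_mono sum_mono)

lemma avg_add: "avg V (\<lambda>x. f x + g x) = avg V f + avg V g"
  by (simp add: avg_def sum.distrib add_divide_distrib)

lemma avg_diff: "avg V (\<lambda>x. f x - g x) = avg V f - avg V g"
  by (simp add: avg_def sum_subtractf diff_divide_distrib)

lemma avg_cmult: "avg V (\<lambda>x. c * f x) = c * avg V f"
  by (simp add: avg_def sum_distrib_left)

lemma avg_multc: "avg V (\<lambda>x. f x * c) = avg V f * c"
  by (simp add: avg_def sum_distrib_right)

lemma avg_sum: "avg V (\<lambda>x. \<Sum>i\<in>A. f i x) = (\<Sum>i\<in>A. avg V (f i))"
  unfolding avg_def by (subst sum.swap) (simp add: sum_divide_distrib)

lemma avg_swap: "avg V (\<lambda>x. avg W (\<lambda>y. f x y)) = avg W (\<lambda>y. avg V (\<lambda>x. f x y))"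
  unfolding avg_def sum_divide_distrib[symmetric]
  by (subst sum.swap) (simp add: mult.commute)

lemma avg_abs: "\<bar>avg V f\<bar> \<le> avg V (\<lambda>x. \<bar>f x\<bar>)"
  by (auto simp: avg_def divide_right_mono)

lemma avg_translate:
  assumes "fin_subgroup V" "a \<in> V"
  shows "avg V (\<lambda>x. f (x + a)) = avg V f"
proof -
  have "bij_betw (\<lambda>x. x + a) V V"
    by (rule bij_betwI[where g="\<lambda>x. x - a"]) (use assms fin_subgroupD[OF assms(1)] in auto)
  then show ?thesis
    unfolding avg_def by (simp add: sum.reindex_bij_betw[of "\<lambda>x. x + a" V V f])
qed

lemma avg_exists_le:
  assumes "fin_subgroup V" "avg V f \<le> c"
  shows "\<exists>x\<in>V. f x \<le> c"
proof (rule ccontr)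
  assume "\<not> ?thesis"
  then have "(\<Sum>x\<in>V. c) < (\<Sum>x\<in>V. f x)"
    using fin_subgroupD[OF assms(1)] by (intro sum_strict_mono) auto
  then show False
    using assms(2) fin_subgroupD(6)[OF assms(1)] by (simp add: avg_def field_simps)
qed

text \<open>This is nonnegativity of the variance, and the only form of Cauchy-Schwarz used
  below.\<close>

lemma avg_square:
  assumes "fin_subgroup V"
  shows "(avg V f)\<^sup>2 \<le> avg V (\<lambda>x. (f x)\<^sup>2)"
proof -
  let ?m = "avg V f"
  have "0 \<le> avg V (\<lambda>x. (f x - ?m)\<^sup>2)"
    using avg_mono[of V "\<lambda>_. 0" "\<lambda>x. (f x - ?m)\<^sup>2"] by (simp add: avg_const[OF assms])
  also have "avg V (\<lambda>x. (f x - ?m)\<^sup>2) = avg V (\<lambda>x. ((f x)\<^sup>2 - (2 * ?m) * f x) + ?m\<^sup>2)"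
    by (rule avg_cong) (simp add: power2_eq_square algebra_simps)
  also have "\<dots> = avg V (\<lambda>x. (f x)\<^sup>2) - ?m\<^sup>2"
    unfolding avg_add avg_diff avg_cmult avg_const[OF assms] by (simp add: power2_eq_square)
  finally show ?thesis by simp
qed

lemma avg_power:
  assumes "fin_subgroup V"
  shows "(avg V f) ^ (2 ^ s) \<le> avg V (\<lambda>x. f x ^ (2 ^ s))"
proof (induction s arbitrary: f)
  case (Suc s)
  have "(avg V f) ^ (2 ^ Suc s) = ((avg V f)\<^sup>2) ^ (2 ^ s)"
    by (simp add: power_mult)
  also have "\<dots> \<le> (avg V (\<lambda>x. (f x)\<^sup>2)) ^ (2 ^ s)"
    by (intro power_mono avg_square assms) auto
  also have "\<dots> \<le> avg V (\<lambda>x. ((f x)\<^sup>2) ^ (2 ^ s))"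
    by (rule Suc)
  finally show ?case by (simp add: power_mult)
qed simp

text \<open>Translating h by \<open>\<sigma> y\<close> and averaging over y leaves Y alone and
  replaces X by its average along the image of \<open>\<sigma>\<close>; squaring then removes Y and
  correlates X with its translates. In the application \<open>\<sigma>\<close> projects to one
  coordinate, so the shifts can be averaged over W itself.\<close>

lemma avg_twisted_square:
  assumes W: "fin_subgroup W" and \<sigma>: "\<And>y. y \<in> W \<Longrightarrow> \<sigma> y \<in> W"
    "\<And>y z. y \<in> W \<Longrightarrow> z \<in> W \<Longrightarrow> \<sigma> (y + z) = \<sigma> y + \<sigma> z"
    and Y: "\<And>h y. h \<in> W \<Longrightarrow> y \<in> W \<Longrightarrow> Y (h + \<sigma> y) = Y h" "\<And>h. h \<in> W \<Longrightarrow> \<bar>Y h\<bar> \<le> 1"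
  shows "(avg W (\<lambda>h. X h * Y h))\<^sup>2 \<le> avg W (\<lambda>y. avg W (\<lambda>h. X h * X (h + \<sigma> y)))"
proof -
  define A where "A h = avg W (\<lambda>y. X (h + \<sigma> y))" for h
  have "avg W (\<lambda>h. X h * Y h) = avg W (\<lambda>y. avg W (\<lambda>h. X h * Y h))"
    by (simp add: avg_const[OF W])
  also have "\<dots> = avg W (\<lambda>y. avg W (\<lambda>h. X (h + \<sigma> y) * Y (h + \<sigma> y)))"
    by (rule avg_cong) (subst avg_translate[OF W, where f="\<lambda>h. X h * Y h"], auto simp: \<sigma>)
  also have "\<dots> = avg W (\<lambda>y. avg W (\<lambda>h. X (h + \<sigma> y) * Y h))"
    by (intro avg_cong) (simp add: Y)
  also have "\<dots> = avg W (\<lambda>h. A h * Y h)"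
    unfolding A_def by (subst avg_swap) (simp add: avg_multc)
  finally have "(avg W (\<lambda>h. X h * Y h))\<^sup>2 \<le> avg W (\<lambda>h. (A h * Y h)\<^sup>2)"
    using avg_square[OF W] by metis
  also have "\<dots> \<le> avg W (\<lambda>h. (A h)\<^sup>2)"
  proof (rule avg_mono)
    fix h assume "h \<in> W"
    then have "(Y h)\<^sup>2 \<le> 1" using Y(2) by (simp add: abs_square_le_1)
    then show "(A h * Y h)\<^sup>2 \<le> (A h)\<^sup>2"
      by (simp add: power_mult_distrib mult_left_le)
  qed
  also have "\<dots> = avg W (\<lambda>h. avg W (\<lambda>y. avg W (\<lambda>z. X (h + \<sigma> y) * X (h + \<sigma> z))))"
    unfolding A_def power2_eq_square avg_cmult avg_multc ..
  \<comment> \<open>Measuring z from y and then translating h by \<open>\<sigma> y\<close> leaves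
    only the difference of the two shifts.\<close>
  also have "\<dots> = avg W (\<lambda>h. avg W (\<lambda>y. avg W (\<lambda>z. X (h + \<sigma> y) * X (h + \<sigma> (z + y)))))"
    by (rule avg_cong, rule avg_cong, rule avg_translate[OF W, symmetric])
  also have "\<dots> = avg W (\<lambda>y. avg W (\<lambda>z. avg W (\<lambda>h. X (h + \<sigma> y) * X (h + \<sigma> y + \<sigma> z))))"
    by (rule trans[OF avg_swap], rule avg_cong, rule trans[OF avg_swap], rule avg_cong, rule avg_cong)
       (simp add: \<sigma> ac_simps)
  also have "\<dots> = avg W (\<lambda>y. avg W (\<lambda>z. avg W (\<lambda>h. X h * X (h + \<sigma> z))))"
    by (rule avg_cong, rule avg_cong, rule avg_translate[OF W]) (rule \<sigma>)
  also have "\<dots> = avg W (\<lambda>z. avg W (\<lambda>h. X h * X (h + \<sigma> z)))"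
    by (simp add: avg_const[OF W])
  finally show ?thesis .
qed

section \<open>Phase polynomials\<close>

text \<open>\<open>phase k\<close> is degree less than \<open>k\<close>, so that \<open>phase 0\<close> is the trivial phase.\<close>

primrec phase :: "nat \<Rightarrow> 'a::ab_group_add set \<Rightarrow> ('a \<Rightarrow> real) \<Rightarrow> bool" where
  "phase 0 V f \<longleftrightarrow> (\<forall>x\<in>V. f x = 1)"
| "phase (Suc k) V f \<longleftrightarrow> (\<forall>x\<in>V. f x = 1 \<or> f x = -1) \<and> (\<forall>a\<in>V. phase k V (\<lambda>x. f (x + a) * f x))"

lemma phase_cong:
  assumes "fin_subgroup V" "\<And>x. x \<in> V \<Longrightarrow> f x = g x"
  shows "phase k V f \<longleftrightarrow> phase k V g"
  using assms(2)
proof (induction k arbitrary: f g)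
  case (Suc k)
  have "phase k V (\<lambda>x. f (x + a) * f x) \<longleftrightarrow> phase k V (\<lambda>x. g (x + a) * g x)" if "a \<in> V" for a
    by (rule Suc.IH) (use Suc.prems that fin_subgroupD[OF assms(1)] in auto)
  then show ?case using Suc.prems by simp
qed simp

lemma phase_pm: "phase k V f \<Longrightarrow> x \<in> V \<Longrightarrow> f x = 1 \<or> f x = -1"
  by (cases k) auto

lemma phase_abs: "phase k V f \<Longrightarrow> x \<in> V \<Longrightarrow> \<bar>f x\<bar> = 1"
  using phase_pm by fastforce

lemma phase_sq: "phase k V f \<Longrightarrow> x \<in> V \<Longrightarrow> f x * f x = 1"
  using phase_pm by fastforce

lemma phase_Suc:
  assumes "fin_subgroup V"
  shows "phase k V f \<Longrightarrow> phase (Suc k) V f"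
proof (induction k arbitrary: f)
  case 0
  then show ?case using fin_subgroupD[OF assms] by simp
next
  case (Suc k)
  have "phase (Suc k) V (\<lambda>x. f (x + a) * f x)" if "a \<in> V" for a
    by (rule Suc.IH) (use Suc.prems that in simp)
  then show ?case using Suc.prems unfolding phase.simps(2)[of "Suc k"] by simp
qed

lemma phase_mono:
  assumes "fin_subgroup V" "phase k V f" "k \<le> l"
  shows "phase l V f"
  using assms(3,2) by (induction l rule: dec_induct) (auto intro: phase_Suc[OF assms(1)] simp del: phase.simps)

lemma phase_one: "fin_subgroup V \<Longrightarrow> phase k V (\<lambda>_. 1)"
  by (rule phase_mono[of _ 0]) auto

lemma phase_mult:
  assumes "fin_subgroup V"
  shows "phase k V f \<Longrightarrow> phase k V g \<Longrightarrow> phase k V (\<lambda>x. f x * g x)"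
proof (induction k arbitrary: f g)
  case (Suc k)
  have "phase k V (\<lambda>x. (f (x + a) * g (x + a)) * (f x * g x))" if "a \<in> V" for a
  proof -
    have "phase k V (\<lambda>x. (f (x + a) * f x) * (g (x + a) * g x))"
      using Suc that by simp
    then show ?thesis by (simp add: mult_ac)
  qed
  moreover have "\<forall>x\<in>V. f x * g x = 1 \<or> f x * g x = -1"
    using Suc.prems phase_pm[OF Suc.prems(1)] phase_pm[OF Suc.prems(2)] by fastforce
  ultimately show ?case by simp
qed simp

lemma phase_prod:
  assumes "fin_subgroup V" "\<And>i. i \<in> A \<Longrightarrow> phase k V (f i)"
  shows "phase k V (\<lambda>x. \<Prod>i\<in>A. f i x)"
  using assms(2)
  by (induction A rule: infinite_finite_induct) (auto simp: phase_one assms(1) intro!: phase_mult)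

lemma phase_comp:
  assumes "\<And>w. w \<in> W \<Longrightarrow> \<phi> w \<in> V" "\<And>w w'. w \<in> W \<Longrightarrow> w' \<in> W \<Longrightarrow> \<phi> (w + w') = \<phi> w + \<phi> w'"
    "fin_subgroup W"
  shows "phase k V f \<Longrightarrow> phase k W (\<lambda>w. f (\<phi> w))"
proof (induction k arbitrary: f)
  case (Suc k)
  have "phase k W (\<lambda>x. f (\<phi> (x + a)) * f (\<phi> x))" if "a \<in> W" for a
  proof -
    have "phase k W (\<lambda>w. f (\<phi> w + \<phi> a) * f (\<phi> w))"
      using Suc.IH[of "\<lambda>x. f (x + \<phi> a) * f x"] Suc.prems that assms by simp
    then show ?thesis
      by (subst (asm) phase_cong[OF assms(3)]) (auto simp: assms that)
  qed
  then show ?case using Suc.prems assms by simp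
qed (use assms in auto)

lemma phase_shift:
  assumes "fin_subgroup V" "a \<in> V"
  shows "phase k V f \<Longrightarrow> phase k V (\<lambda>x. f (x + a))"
proof (induction k arbitrary: f)
  case (Suc k)
  have "phase k V (\<lambda>x. f (x + b + a) * f (x + a))" if "b \<in> V" for b
  proof -
    have "phase k V (\<lambda>x. f (x + a + b) * f (x + a))"
      using Suc.IH[of "\<lambda>x. f (x + b) * f x"] Suc.prems that by simp
    then show ?thesis by (simp only: add.assoc add.commute[of a b])
  qed
  then show ?case using Suc.prems fin_subgroupD[OF assms(1)] assms(2) by simp
qed (use fin_subgroupD[OF assms(1)] assms(2) in auto)

text \<open>\<open>k - 1\<close> also covers index 0: there f is 1 and so are its
  derivatives.\<close>

lemma phase_deriv:
  assumes "fin_subgroup V" "a \<in> V" "phase k V f"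
  shows "phase (k - 1) V (\<lambda>x. f (x + a) * f x)"
  using assms fin_subgroupD[OF assms(1)] by (cases k) auto

lemma prod_Pow_insert:
  fixes f :: "'b set \<Rightarrow> 'c::comm_monoid_mult"
  assumes "finite A" "a \<notin> A"
  shows "(\<Prod>J\<in>Pow (insert a A). f J) = (\<Prod>J\<in>Pow A. f J * f (insert a J))"
proof -
  have "inj_on (insert a) (Pow A)"
    using assms(2) by (auto simp: inj_on_def insert_eq_iff)
  moreover have "Pow A \<inter> insert a ` Pow A = {}" using assms(2) by auto
  ultimately show ?thesis
    using assms by (simp add: Pow_insert prod.union_disjoint prod.reindex prod.distrib)
qed

text \<open>Pairing J with \<open>insert k J\<close> turns the cube product of f into that of its
  derivative in direction \<open>h k\<close>. Signs are their own inverses, so no alternating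
  exponents occur.\<close>

lemma phase_cube:
  assumes V: "fin_subgroup V"
  shows "phase k V f \<Longrightarrow> x \<in> V \<Longrightarrow> (\<And>j. j < k \<Longrightarrow> h j \<in> V) \<Longrightarrow>
    (\<Prod>J\<in>Pow {..<k}. f (x + (\<Sum>j\<in>J. h j))) = 1"
proof (induction k arbitrary: f)
  case (Suc k)
  have "(\<Prod>J\<in>Pow {..<Suc k}. f (x + (\<Sum>j\<in>J. h j))) =
      (\<Prod>J\<in>Pow {..<k}. f (x + (\<Sum>j\<in>J. h j) + h k) * f (x + (\<Sum>j\<in>J. h j)))"
    unfolding lessThan_Suc
  proof (subst prod_Pow_insert, simp_all, rule prod.cong, simp)
    fix J assume "J \<in> Pow {..<k}"
    then have "finite J" "k \<notin> J" by (auto intro: finite_subset)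
    then show "f (x + sum h J) * f (x + sum h (insert k J)) = f (x + sum h J + h k) * f (x + sum h J)"
      by (simp add: algebra_simps)
  qed
  also have "\<dots> = 1"
    using Suc.IH[of "\<lambda>x. f (x + h k) * f x"] Suc.prems by simp
  finally show ?case .
qed (use V in auto)

section \<open>The Gowers--Cauchy--Schwarz inequality\<close>

text \<open>Vectors indexed by K are stored as functions vanishing off K. Every power of V is thus a
  finite subgroup of the single type \<open>nat \<Rightarrow> 'a\<close>, whatever its
  exponent.\<close>

definition power_group :: "'a::ab_group_add set \<Rightarrow> nat set \<Rightarrow> (nat \<Rightarrow> 'a) set" where
  "power_group V K = {h. (\<forall>j\<in>K. h j \<in> V) \<and> (\<forall>j. j \<notin> K \<longrightarrow> h j = 0)}"

definition sgl :: "nat \<Rightarrow> 'a::zero \<Rightarrow> nat \<Rightarrow> 'a" where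
  "sgl j v = (\<lambda>i. if i = j then v else 0)"

definition restr :: "nat set \<Rightarrow> (nat \<Rightarrow> 'a::zero) \<Rightarrow> nat \<Rightarrow> 'a" where
  "restr S y = (\<lambda>i. if i \<in> S then y i else 0)"

lemma fin_subgroup_power_group:
  assumes "fin_subgroup V" "finite K"
  shows "fin_subgroup (power_group V K)"
proof -
  have "finite (power_group V K)"
    using finite_set_of_finite_funs[OF assms(2) fin_subgroupD(1)[OF assms(1)], of 0]
    by (rule back_subst[of finite]) (auto simp: power_group_def)
  then show ?thesis
    using fin_subgroupD[OF assms(1)] by (auto simp: fin_subgroup_def power_group_def)
qed

lemma sgl_power_group: "fin_subgroup V \<Longrightarrow> j \<in> K \<Longrightarrow> v \<in> V \<Longrightarrow> sgl j v \<in> power_group V K"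
  by (auto simp: power_group_def sgl_def fin_subgroupD)

lemma sgl_add: "sgl j (u + v) = sgl j u + sgl j (v::'a::ab_group_add)"
  by (auto simp: sgl_def)

lemma sgl_at: "sgl j v j = v"
  by (simp add: sgl_def)

lemma restr_insert: "j \<notin> S \<Longrightarrow> restr (insert j S) y = restr S y + sgl j (y j :: 'a::ab_group_add)"
  by (auto simp: restr_def sgl_def)

lemma restr_add_sgl: "j \<notin> S \<Longrightarrow> restr S (y + sgl j v) = restr S (y :: nat \<Rightarrow> 'a::ab_group_add)"
  by (auto simp: restr_def sgl_def fun_eq_iff)

text \<open>Nothing in \<open>K z\<close> sees the coordinate j of z, so by independence y may lend
  its own. Formally, y is translated by z, and its coordinate j is then absorbed in a translation of
  z.\<close>

lemma avg_merge_coordinate: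
  assumes W: "fin_subgroup W" and sgl: "\<And>y. y \<in> W \<Longrightarrow> sgl j (y j) \<in> W"
    and K: "\<And>y v. y \<in> W \<Longrightarrow> K (y + sgl j v) = (K y :: 'a::ab_group_add \<Rightarrow> real)"
  shows "avg W (\<lambda>y. avg W (\<lambda>z. K z (y j))) = avg W (\<lambda>y. K y (y j))"
proof -
  have "avg W (\<lambda>y. avg W (\<lambda>z. K z (y j))) = avg W (\<lambda>z. avg W (\<lambda>y. K z (y j)))"
    by (rule avg_swap)
  also have "\<dots> = avg W (\<lambda>z. avg W (\<lambda>y. K z ((y + z) j)))"
    by (rule avg_cong, rule avg_translate[OF W, symmetric])
  also have "\<dots> = avg W (\<lambda>y. avg W (\<lambda>z. K (z + sgl j (y j)) ((z + sgl j (y j)) j)))"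
    by (rule trans[OF avg_swap], rule avg_cong, rule avg_cong)
       (simp add: K sgl_at add.commute)
  also have "\<dots> = avg W (\<lambda>y. avg W (\<lambda>z. K z (z j)))"
    by (rule avg_cong, rule avg_translate[OF W]) (rule sgl)
  also have "\<dots> = avg W (\<lambda>z. K z (z j))"
    by (rule avg_const[OF W])
  finally show ?thesis .
qed

text \<open>One Cauchy-Schwarz per coordinate of I. The step for j discards the factors that ignore
  j and multiplies F and every remaining factor by its translate in direction j. At the end only F
  is left, multiplied over a box. The average stays over the whole power, so the induction never
  changes the group.\<close>

lemma gowers_cauchy_schwarz:
  fixes F :: "(nat \<Rightarrow> 'a::ab_group_add) \<Rightarrow> real"
  assumes V: "fin_subgroup V" and K: "finite K" and "finite I"
  shows "I \<subseteq> K \<Longrightarrow> finite \<J> \<Longrightarrow>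
    (\<And>J. J \<in> \<J> \<Longrightarrow> \<exists>j\<in>I. \<forall>w\<in>power_group V K. \<forall>v\<in>V. b J (w + sgl j v) = b J w) \<Longrightarrow>
    (\<And>J w. J \<in> \<J> \<Longrightarrow> w \<in> power_group V K \<Longrightarrow> \<bar>b J w\<bar> \<le> 1) \<Longrightarrow>
    (avg (power_group V K) (\<lambda>w. F w * (\<Prod>J\<in>\<J>. b J w))) ^ (2 ^ card I)
      \<le> avg (power_group V K) (\<lambda>y. avg (power_group V K) (\<lambda>h. \<Prod>S\<in>Pow I. F (h + restr S y)))"
  using assms(3)
proof (induction I arbitrary: F b \<J>)
  case empty
  then have "\<J> = {}" by auto
  moreover have "h + restr {} y = h" for h y :: "nat \<Rightarrow> 'a" by (auto simp: restr_def)
  ultimately show ?case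
    using avg_const[OF fin_subgroup_power_group[OF V K]] by simp
next
  case (insert j I)
  define W where "W = power_group V K"
  have W: "fin_subgroup W" unfolding W_def by (rule fin_subgroup_power_group[OF V K])
  have jK: "j \<in> K" using insert.prems(1) by auto
  define inv where "inv J \<longleftrightarrow> (\<forall>w\<in>W. \<forall>v\<in>V. b J (w + sgl j v) = b J w)" for J
  \<comment> \<open>\<open>\<J>0\<close> is removed in this round; a factor in \<open>\<J>1\<close>
    ignores some coordinate other than j, hence one in I.\<close>
  define \<J>0 where "\<J>0 = {J\<in>\<J>. inv J}"
  define \<J>1 where "\<J>1 = {J\<in>\<J>. \<not> inv J}"
  have fin: "finite \<J>0" "finite \<J>1" and un: "\<J> = \<J>0 \<union> \<J>1" "\<J>0 \<inter> \<J>1 = {}"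
    using insert.prems(2) by (auto simp: \<J>0_def \<J>1_def)
  define X where "X h = F h * (\<Prod>J\<in>\<J>1. b J h)" for h
  define Y where "Y h = (\<Prod>J\<in>\<J>0. b J h)" for h
  have yj: "y j \<in> V" if "y \<in> W" for y using that jK by (auto simp: W_def power_group_def)
  have sg: "sgl j v \<in> W" if "v \<in> V" for v unfolding W_def by (rule sgl_power_group[OF V jK that])
  have Y1: "\<bar>Y h\<bar> \<le> 1" if "h \<in> W" for h
    unfolding Y_def abs_prod
    by (rule prod_le_1) (use insert.prems(4) that in \<open>auto simp: \<J>0_def W_def\<close>)
  have Y2: "Y (h + sgl j v) = Y h" if "h \<in> W" "v \<in> V" for h v
    unfolding Y_def by (rule prod.cong) (use that in \<open>auto simp: \<J>0_def inv_def\<close>)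
  define F' where "F' y h = F h * F (h + sgl j (y j))" for y h
  define b' where "b' y J h = b J h * b J (h + sgl j (y j))" for y J h
  have step: "(avg W (\<lambda>h. F' y h * (\<Prod>J\<in>\<J>1. b' y J h))) ^ (2 ^ card I)
      \<le> avg W (\<lambda>z. avg W (\<lambda>h. \<Prod>S\<in>Pow I. F' y (h + restr S z)))" if y: "y \<in> W" for y
    unfolding W_def
  proof (rule insert.IH)
    show "I \<subseteq> K" using insert.prems(1) by auto
    show "finite \<J>1" by fact
  next
    fix J assume J: "J \<in> \<J>1"
    then obtain i where i: "i \<in> insert j I" "\<forall>w\<in>W. \<forall>v\<in>V. b J (w + sgl i v) = b J w"
      using insert.prems(3)[of J] unfolding \<J>1_def W_def by blast
    have "i \<noteq> j" using J i(2) unfolding \<J>1_def inv_def by blast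
    then have "i \<in> I" using i by auto
    moreover have "b' y J (w + sgl i v) = b' y J w" if "w \<in> W" "v \<in> V" for w v
    proof -
      have "w + sgl j (y j) \<in> W" using that sg yj[OF y] fin_subgroupD(3)[OF W] by auto
      then have "b J (w + sgl j (y j) + sgl i v) = b J (w + sgl j (y j))"
        using i(2) that by blast
      moreover have "w + sgl i v + sgl j (y j) = w + sgl j (y j) + sgl i v"
        by (simp only: ac_simps)
      ultimately show ?thesis using i(2) that unfolding b'_def by metis
    qed
    ultimately show "\<exists>j\<in>I. \<forall>w\<in>power_group V K. \<forall>v\<in>V. b' y J (w + sgl j v) = b' y J w"
      unfolding W_def by blast
  next
    fix J w assume J: "J \<in> \<J>1" "w \<in> power_group V K"
    then have "w \<in> W" "w + sgl j (y j) \<in> W"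
      using sg yj[OF y] fin_subgroupD(3)[OF W] by (auto simp: W_def)
    then have "\<bar>b J w\<bar> \<le> 1" "\<bar>b J (w + sgl j (y j))\<bar> \<le> 1"
      using insert.prems(4) J by (auto simp: \<J>1_def W_def)
    then show "\<bar>b' y J w\<bar> \<le> 1"
      by (simp add: b'_def abs_mult mult_le_one)
  qed
  have "(avg W (\<lambda>w. F w * (\<Prod>J\<in>\<J>. b J w))) ^ (2 ^ card (insert j I)) =
      ((avg W (\<lambda>h. X h * Y h))\<^sup>2) ^ (2 ^ card I)"
    using insert.hyps un(2) fin
    by (simp add: power_mult un(1) prod.union_disjoint X_def Y_def mult_ac)
  also have "\<dots> \<le> (avg W (\<lambda>y. avg W (\<lambda>h. X h * X (h + sgl j (y j))))) ^ (2 ^ card I)"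
    by (intro power_mono avg_twisted_square[OF W])
       (simp_all add: sg yj Y1 Y2 sgl_add)
  also have "\<dots> \<le> avg W (\<lambda>y. (avg W (\<lambda>h. X h * X (h + sgl j (y j)))) ^ (2 ^ card I))"
    by (rule avg_power[OF W])
  also have "\<dots> = avg W (\<lambda>y. (avg W (\<lambda>h. F' y h * (\<Prod>J\<in>\<J>1. b' y J h))) ^ (2 ^ card I))"
    by (simp add: X_def F'_def b'_def prod.distrib mult_ac)
  also have "\<dots> \<le> avg W (\<lambda>y. avg W (\<lambda>z. avg W (\<lambda>h. \<Prod>S\<in>Pow I. F' y (h + restr S z))))"
    by (rule avg_mono) (rule step)
  \<comment> \<open>The outer y contributes only its coordinate j and z only coordinates in I, so
    the two points merge into one.\<close>
  also have "\<dots> = avg W (\<lambda>y. avg W (\<lambda>h. \<Prod>S\<in>Pow I. F (h + restr S y) * F (h + restr S y + sgl j (y j))))"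
    unfolding F'_def
  proof (rule avg_merge_coordinate[OF W, where K="\<lambda>y v. avg W (\<lambda>h. \<Prod>S\<in>Pow I. F (h + restr S y) * F (h + restr S y + sgl j v))"])
    show "sgl j (y j) \<in> W" if "y \<in> W" for y
      using that by (simp add: sg yj)
    have rs: "restr S (y + sgl j v) = restr S y" if "S \<in> Pow I" for S v and y :: "nat \<Rightarrow> 'a"
      using that insert.hyps(2) by (intro restr_add_sgl) auto
    show "(\<lambda>u. avg W (\<lambda>h. \<Prod>S\<in>Pow I. F (h + restr S (y + sgl j v)) * F (h + restr S (y + sgl j v) + sgl j u))) =
        (\<lambda>u. avg W (\<lambda>h. \<Prod>S\<in>Pow I. F (h + restr S y) * F (h + restr S y + sgl j u)))" for y v
      by (intro ext avg_cong prod.cong) (simp_all only: rs)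
  qed
  also have "\<dots> = avg W (\<lambda>y. avg W (\<lambda>h. \<Prod>S\<in>Pow (insert j I). F (h + restr S y)))"
  proof (intro avg_cong, subst prod_Pow_insert[OF insert.hyps], rule prod.cong)
    fix y h :: "nat \<Rightarrow> 'a" and S assume "S \<in> Pow I"
    then have "j \<notin> S" using insert.hyps by auto
    then show "F (h + restr S y) * F (h + restr S y + sgl j (y j)) =
        F (h + restr S y) * F (h + restr (insert j S) y)"
      by (simp add: restr_insert ac_simps)
  qed simp
  finally show ?case unfolding W_def .
qed

section \<open>Fourier expansion of a function of signs\<close>

text \<open>Splitting on the sign of \<open>g a\<close> writes F as (G 1 + G (-1)) / 2 + g a * (G 1
  - G (-1)) / 2; each sign costs one factor 2 in the denominators. Since not every sign pattern need
  occur on W, the coefficients are not correlations of F but depend on how F is extended to the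
  missing patterns.\<close>

lemma sign_fourier:
  assumes "finite A" "\<And>a w. a \<in> A \<Longrightarrow> w \<in> W \<Longrightarrow> g a w = (1::real) \<or> g a w = -1"
  shows "(\<And>w. w \<in> W \<Longrightarrow> \<bar>F w\<bar> \<le> 1) \<Longrightarrow> (\<And>w. w \<in> W \<Longrightarrow> F w * 2 ^ k \<in> \<int>) \<Longrightarrow>
    (\<And>x y. x \<in> W \<Longrightarrow> y \<in> W \<Longrightarrow> (\<And>a. a \<in> A \<Longrightarrow> g a x = g a y) \<Longrightarrow> F x = F y) \<Longrightarrow>
    \<exists>\<gamma>. (\<forall>S. \<bar>\<gamma> S\<bar> \<le> 1 \<and> \<gamma> S * 2 ^ (k + card A) \<in> \<int>) \<and>
      (\<forall>w\<in>W. F w = (\<Sum>S\<in>Pow A. \<gamma> S * (\<Prod>a\<in>S. g a w)))"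
  using assms
proof (induction A arbitrary: F k rule: finite_induct)
  case empty
  show ?case
  proof (cases "W = {}")
    case True
    then show ?thesis by (intro exI[of _ "\<lambda>_. 0"]) auto
  next
    case False
    then obtain w0 where w0: "w0 \<in> W" by auto
    have "F w = (\<Sum>S\<in>Pow {}. F w0 * (\<Prod>a\<in>S. g a w))" if "w \<in> W" for w
      using empty.prems(3)[OF that w0] by simp
    moreover have "\<bar>F w0\<bar> \<le> 1" "F w0 * 2 ^ (k + card {}) \<in> \<int>"
      using empty.prems(1,2)[OF w0] by simp_all
    ultimately show ?thesis by (intro exI[of _ "\<lambda>_. F w0"]) blast
  qed
next
  case (insert a B)
  define P where "P s w w' \<longleftrightarrow> w' \<in> W \<and> g a w' = s \<and> (\<forall>c\<in>B. g c w' = g c w)" for s w w'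
  \<comment> \<open>The value of F at a point that has the B-signs of w and \<open>g a\<close> equal
    to s. The default 0 for missing patterns keeps both the bound and the integrality.\<close>
  define G where "G s w = (if \<exists>w'. P s w w' then F (SOME w'. P s w w') else 0)" for s w
  have GF: "G s w = F w'" if "P s w w'" for s w w'
  proof -
    have "P s w (SOME w'. P s w w')" using that by (rule someI)
    then have "F (SOME w'. P s w w') = F w'"
      using that by (intro insert.prems(3)) (auto simp: P_def)
    then show ?thesis using that by (auto simp: G_def)
  qed
  have G_or: "G s w = 0 \<or> (\<exists>w'\<in>W. G s w = F w')" for s w
  proof (cases "\<exists>w'. P s w w'")
    case True
    then show ?thesis using GF[of s w] by (metis P_def)
  qed (simp add: G_def)
  have G1: "\<bar>G s w\<bar> \<le> 1" "G s w * 2 ^ k \<in> \<int>" for s w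
    using G_or[of s w] insert.prems(1,2) by auto
  have Gdet: "G s x = G s y" if "\<And>c. c \<in> B \<Longrightarrow> g c x = g c y" for s x y
  proof -
    have "P s x = P s y" using that by (auto simp: P_def fun_eq_iff)
    then show ?thesis by (simp add: G_def)
  qed
  \<comment> \<open>s = 1 yields the coefficients of products without a, and s = -1 those with a;
    halving moves the exponent from k to \<open>Suc k\<close>.\<close>
  have ex: "\<exists>\<gamma>. (\<forall>S. \<bar>\<gamma> S\<bar> \<le> 1 \<and> \<gamma> S * 2 ^ (Suc k + card B) \<in> \<int>) \<and>
      (\<forall>w\<in>W. (G 1 w + s * G (-1) w) / 2 = (\<Sum>S\<in>Pow B. \<gamma> S * (\<Prod>a\<in>S. g a w)))"
    if s: "s = 1 \<or> s = -1" for s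
  proof (rule insert.IH)
    fix w assume "w \<in> W"
    show "\<bar>(G 1 w + s * G (-1) w) / 2\<bar> \<le> 1"
      using G1(1)[of 1 w] G1(1)[of "-1" w] s by auto
    have "(G 1 w + s * G (-1) w) / 2 * 2 ^ Suc k = G 1 w * 2 ^ k + s * (G (-1) w * 2 ^ k)"
      by (simp add: algebra_simps)
    also have "\<dots> \<in> \<int>" using G1(2) s by auto
    finally show "(G 1 w + s * G (-1) w) / 2 * 2 ^ Suc k \<in> \<int>" .
  next
    fix x y assume "\<And>c. c \<in> B \<Longrightarrow> g c x = g c y"
    then show "(G 1 x + s * G (-1) x) / 2 = (G 1 y + s * G (-1) y) / 2"
      using Gdet by metis
  qed (use insert.prems(4) in auto)
  obtain \<gamma>0 where \<gamma>0: "\<And>S. \<bar>\<gamma>0 S\<bar> \<le> 1" "\<And>S. \<gamma>0 S * 2 ^ (Suc k + card B) \<in> \<int>"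
      "\<And>w. w \<in> W \<Longrightarrow> (G 1 w + G (-1) w) / 2 = (\<Sum>S\<in>Pow B. \<gamma>0 S * (\<Prod>a\<in>S. g a w))"
    using ex[of 1] by auto
  obtain \<gamma>1 where \<gamma>1: "\<And>S. \<bar>\<gamma>1 S\<bar> \<le> 1" "\<And>S. \<gamma>1 S * 2 ^ (Suc k + card B) \<in> \<int>"
      "\<And>w. w \<in> W \<Longrightarrow> (G 1 w - G (-1) w) / 2 = (\<Sum>S\<in>Pow B. \<gamma>1 S * (\<Prod>a\<in>S. g a w))"
    using ex[of "-1"] by auto
  define \<gamma> where "\<gamma> S = (if a \<in> S then \<gamma>1 (S - {a}) else \<gamma>0 S)" for S
  have "F w = (\<Sum>S\<in>Pow (insert a B). \<gamma> S * (\<Prod>a\<in>S. g a w))" if w: "w \<in> W" for w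
  proof -
    have "g a w = 1 \<or> g a w = -1" using insert.prems(4) w by auto
    moreover have "G (g a w) w = F w" by (rule GF) (auto simp: P_def w)
    ultimately have "F w = (G 1 w + G (-1) w) / 2 + g a w * ((G 1 w - G (-1) w) / 2)"
      by (auto simp: field_simps)
    also have "\<dots> = (\<Sum>S\<in>Pow B. \<gamma>0 S * (\<Prod>a\<in>S. g a w)) + (\<Sum>S\<in>Pow B. \<gamma>1 S * (g a w * (\<Prod>a\<in>S. g a w)))"
      by (simp add: \<gamma>0(3) \<gamma>1(3) w sum_distrib_left mult_ac)
    also have "(\<Sum>S\<in>Pow B. \<gamma>0 S * (\<Prod>a\<in>S. g a w)) = (\<Sum>S\<in>Pow B. \<gamma> S * (\<Prod>a\<in>S. g a w))"
      by (rule sum.cong) (use insert.hyps in \<open>auto simp: \<gamma>_def\<close>)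
    also have "(\<Sum>S\<in>Pow B. \<gamma>1 S * (g a w * (\<Prod>a\<in>S. g a w))) =
        (\<Sum>S\<in>insert a ` Pow B. \<gamma> S * (\<Prod>a\<in>S. g a w))"
    proof -
      have "inj_on (insert a) (Pow B)"
        using insert.hyps by (auto simp: inj_on_def insert_eq_iff)
      then show ?thesis
      proof (subst sum.reindex, simp, intro sum.cong, simp)
        fix S assume "S \<in> Pow B"
        then have "finite S" "a \<notin> S" using insert.hyps by (auto intro: finite_subset)
        then show "\<gamma>1 S * (g a w * (\<Prod>a\<in>S. g a w)) = ((\<lambda>S. \<gamma> S * (\<Prod>a\<in>S. g a w)) \<circ> insert a) S"
          by (simp add: \<gamma>_def)
      qed
    qed
    also have "(\<Sum>S\<in>Pow B. \<gamma> S * (\<Prod>a\<in>S. g a w)) + (\<Sum>S\<in>insert a ` Pow B. \<gamma> S * (\<Prod>a\<in>S. g a w))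
        = (\<Sum>S\<in>Pow (insert a B). \<gamma> S * (\<Prod>a\<in>S. g a w))"
      unfolding Pow_insert
      by (rule sum.union_disjoint[symmetric]) (use insert.hyps in auto)
    finally show ?thesis .
  qed
  moreover have "\<bar>\<gamma> S\<bar> \<le> 1 \<and> \<gamma> S * 2 ^ (k + card (insert a B)) \<in> \<int>" for S
    using \<gamma>0(1,2) \<gamma>1(1,2) insert.hyps by (simp add: \<gamma>_def)
  ultimately show ?case by blast
qed

section \<open>Derivatives determine a biased phase polynomial\<close>

definition derivs_determine :: "'a::ab_group_add set \<Rightarrow> nat \<Rightarrow> ('a \<Rightarrow> real) \<Rightarrow> bool" where
  "derivs_determine V C f \<longleftrightarrow> (\<exists>A\<subseteq>V. card A \<le> C \<and>
     (\<forall>x\<in>V. \<forall>y\<in>V. (\<forall>a\<in>A. f (x + a) * f x = f (y + a) * f y) \<longrightarrow> f x = f y))"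

text \<open>The bias-rank theorem for all finite groups inside one type. The type is a parameter
  because index \<open>Suc r\<close> in \<open>'a\<close> will rest on the smaller indices in
  \<open>nat \<Rightarrow> 'a\<close>. C may depend on it, but not on the group or the
  phase.\<close>

definition bias_rank :: "'a::ab_group_add itself \<Rightarrow> nat \<Rightarrow> bool" where
  "bias_rank _ r \<longleftrightarrow> (\<forall>\<epsilon>>0. \<exists>C. \<forall>(V::'a set) f. fin_subgroup V \<longrightarrow> phase r V f \<longrightarrow> \<epsilon> \<le> \<bar>avg V f\<bar> \<longrightarrow>
     derivs_determine V C f)"

lemma bias_rankD:
  assumes "bias_rank TYPE('a::ab_group_add) r" "\<epsilon> > 0"
  shows "\<exists>C. \<forall>(V::'a set) f. fin_subgroup V \<longrightarrow> phase r V f \<longrightarrow> \<epsilon> \<le> \<bar>avg V f\<bar> \<longrightarrow> derivs_determine V C f"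
  using assms unfolding bias_rank_def by simp

text \<open>On the image of V the inverse of e is again additive, so phases, averages and directions
  carry over with the same C.\<close>

lemma bias_rank_transfer:
  fixes e :: "'b::ab_group_add \<Rightarrow> 'a::ab_group_add"
  assumes e: "inj e" "\<And>x y. e (x + y) = e x + e y" and r: "bias_rank TYPE('a) r"
  shows "bias_rank TYPE('b) r"
  unfolding bias_rank_def
proof (intro allI impI)
  fix \<epsilon> :: real assume "\<epsilon> > 0"
  from bias_rankD[OF r this] obtain C where C: "\<And>(V::'a set) f. fin_subgroup V \<Longrightarrow> phase r V f \<Longrightarrow>
     \<epsilon> \<le> \<bar>avg V f\<bar> \<Longrightarrow> derivs_determine V C f"
    by blast
  have e0: "e 0 = 0" using e(2)[of 0 0] by simp
  have em: "e (- x) = - e x" for x using e(2)[of x "- x"] e0 by (simp add: eq_neg_iff_add_eq_0 add.commute)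
  have inv: "inv e (e x) = x" for x using e(1) by simp
  show "\<exists>C. \<forall>(V::'b set) f. fin_subgroup V \<longrightarrow> phase r V f \<longrightarrow> \<epsilon> \<le> \<bar>avg V f\<bar> \<longrightarrow>
     derivs_determine V C f"
  proof (intro exI[of _ C] allI impI)
    fix V :: "'b set" and f assume V: "fin_subgroup V" and f: "phase r V f" and b: "\<epsilon> \<le> \<bar>avg V f\<bar>"
    have V': "fin_subgroup (e ` V)"
      using fin_subgroupD[OF V] e0 unfolding fin_subgroup_def by (auto simp flip: e(2) em)
    have f': "phase r (e ` V) (\<lambda>x. f (inv e x))"
      by (rule phase_comp[OF _ _ V' f]) (auto simp: inv simp flip: e(2))
    have "avg (e ` V) (\<lambda>x. f (inv e x)) = avg V f"
      using inj_on_subset[OF e(1), of V]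
      by (simp add: avg_def sum.reindex inv card_image)
    then have "derivs_determine (e ` V) C (\<lambda>x. f (inv e x))"
      using b by (intro C[OF V' f']) simp
    then obtain A where A: "A \<subseteq> e ` V" "card A \<le> C"
      and det: "\<forall>x\<in>e ` V. \<forall>y\<in>e ` V. (\<forall>a\<in>A. f (inv e (x + a)) * f (inv e x) =
        f (inv e (y + a)) * f (inv e y)) \<longrightarrow> f (inv e x) = f (inv e y)"
      unfolding derivs_determine_def by (elim exE conjE)
    show "derivs_determine V C f"
      unfolding derivs_determine_def
    proof (intro exI[of _ "inv e ` A"] conjI ballI impI)
      show "inv e ` A \<subseteq> V" using A inv by auto
      have "finite A" using A(1) fin_subgroupD(1)[OF V] finite_subset by blast
      then show "card (inv e ` A) \<le> C"
        using A(2) card_image_le le_trans by blast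
      fix x y assume xy: "x \<in> V" "y \<in> V" and *: "\<forall>a\<in>inv e ` A. f (x + a) * f x = f (y + a) * f y"
      have "f (inv e (e x)) = f (inv e (e y))"
      proof (rule det[THEN bspec, THEN bspec, THEN mp], simp_all only: xy imageI inv, rule ballI)
        fix a assume a: "a \<in> A"
        then obtain c where c: "a = e c" using A(1) by auto
        have "inv e a \<in> inv e ` A" using a by (rule imageI)
        then have "c \<in> inv e ` A" unfolding c inv .
        from bspec[OF * this] show "f (inv e (e x + a)) * f x = f (inv e (e y + a)) * f y"
          unfolding c by (simp only: inv flip: e(2))
      qed
      then show "f x = f y" by (simp add: inv)
    qed
  qed
qed

text \<open>The cube phase of a phase lives on a power of the group, so the induction on the degree must
  stay within a type that contains its own powers.\<close>

lemma bias_rank_powers: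
  assumes "bias_rank TYPE(nat \<Rightarrow> 'c::ab_group_add) r"
  shows "bias_rank TYPE(nat \<Rightarrow> nat \<Rightarrow> 'c) r"
proof (rule bias_rank_transfer[OF _ _ assms])
  define e :: "(nat \<Rightarrow> nat \<Rightarrow> 'c) \<Rightarrow> nat \<Rightarrow> 'c"
    where "e h = (\<lambda>m. h (fst (prod_decode m)) (snd (prod_decode m)))" for h
  show "inj e"
  proof (rule injI, intro ext)
    fix h h' :: "nat \<Rightarrow> nat \<Rightarrow> 'c" and i j :: nat assume "e h = e h'"
    then have "e h (prod_encode (i, j)) = e h' (prod_encode (i, j))" by simp
    then show "h i j = h' i j" by (simp add: e_def)
  qed
  show "e (h + h') = e h + e h'" for h h' by (auto simp: e_def)
qed

section \<open>Cube averages are determined through few shifts\<close>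

text \<open>A Gowers-type average with its own function at each vertex of the cubes based at x. The
  edges will use the coordinates below k; coordinate k is included so that the base point of a cube
  can later vary within the same power of V.\<close>

definition cube_avg :: "'a::ab_group_add set \<Rightarrow> nat \<Rightarrow> nat set set \<Rightarrow> (nat set \<Rightarrow> 'a \<Rightarrow> real) \<Rightarrow> 'a \<Rightarrow> real" where
  "cube_avg V k \<L> q x = avg (power_group V {..k}) (\<lambda>h. \<Prod>J\<in>\<L>. q J (x + (\<Sum>j\<in>J. h j)))"

lemma sum_sgl:
  fixes h :: "nat \<Rightarrow> 'a::ab_group_add"
  shows "finite J \<Longrightarrow> (\<Sum>i\<in>J. (h + sgl j v) i) = (\<Sum>i\<in>J. h i) + (if j \<in> J then v else 0)"
  by (subst plus_fun_apply, subst sum.distrib, subst sgl_def, subst sum.delta) (assumption, rule refl)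

lemma sum_restr:
  fixes h :: "nat \<Rightarrow> 'a::ab_group_add"
  shows "finite J \<Longrightarrow> S \<subseteq> J \<Longrightarrow> (\<Sum>i\<in>J. (h + restr S y) i) = (\<Sum>i\<in>J. h i) + (\<Sum>i\<in>S. y i)"
  by (subst plus_fun_apply, subst sum.distrib, subst restr_def, subst sum.inter_restrict[symmetric],
      assumption, subst Int_absorb1) (assumption, rule refl)

text \<open>Every other vertex J misses some j in I and so ignores the edge \<open>h j\<close>;
  Gowers-Cauchy-Schwarz therefore isolates \<open>q I\<close>. What remains is the mean of the cube
  phase of \<open>q I\<close>, a bound independent of x.\<close>

lemma cube_avg_le_cube_bias:
  fixes V :: "'a::ab_group_add set"
  assumes V: "fin_subgroup V" and I: "I \<subseteq> {..<k}" "I \<noteq> {}" and \<L>: "\<L> \<subseteq> Pow {..<k}" "\<And>J. J \<in> \<L> \<Longrightarrow> \<not> I \<subseteq> J"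
    and q: "\<And>J x. J \<in> \<L> \<Longrightarrow> x \<in> V \<Longrightarrow> \<bar>q J x\<bar> \<le> 1" and x: "x \<in> V"
  shows "(cube_avg V k (insert I \<L>) q x) ^ (2 ^ card I)
    \<le> avg (power_group V {..k}) (\<lambda>w. \<Prod>S\<in>Pow I. q I (w k + (\<Sum>j\<in>S. w j)))"
proof -
  define W where "W = power_group V {..k}"
  have W: "fin_subgroup W" unfolding W_def by (rule fin_subgroup_power_group[OF V]) simp
  have fin: "finite I" "finite \<L>" "\<And>J. J \<in> \<L> \<Longrightarrow> finite J"
    using I \<L>(1) finite_subset[of _ "{..<k}"] finite_subset[of \<L> "Pow {..<k}"] by auto
  have "I \<notin> \<L>" using \<L>(2) by auto
  have hV: "(\<Sum>j\<in>J. h j) \<in> V" if "h \<in> W" "J \<subseteq> {..<k}" for h J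
    by (rule fin_subgroup_sum[OF V]) (use that in \<open>auto simp: W_def power_group_def\<close>)
  define g where "g u y = (\<Prod>S\<in>Pow I. q I (u + (\<Sum>j\<in>S. y j)))" for u and y :: "nat \<Rightarrow> 'a"
  have "(cube_avg V k (insert I \<L>) q x) ^ (2 ^ card I) =
      (avg W (\<lambda>h. q I (x + (\<Sum>j\<in>I. h j)) * (\<Prod>J\<in>\<L>. q J (x + (\<Sum>j\<in>J. h j))))) ^ (2 ^ card I)"
    unfolding cube_avg_def W_def using fin \<open>I \<notin> \<L>\<close> by simp
  also have "\<dots> \<le> avg W (\<lambda>y. avg W (\<lambda>h. \<Prod>S\<in>Pow I. q I (x + (\<Sum>j\<in>I. (h + restr S y) j))))"
    unfolding W_def
  proof (rule gowers_cauchy_schwarz[OF V _ fin(1), where F="\<lambda>h. q I (x + (\<Sum>j\<in>I. h j))"])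
    show "I \<subseteq> {..k}" using I by auto
    show "finite \<L>" by fact
  next
    fix J assume J: "J \<in> \<L>"
    then obtain j where "j \<in> I" "j \<notin> J" using \<L>(2) by auto
    then show "\<exists>j\<in>I. \<forall>w\<in>power_group V {..k}. \<forall>v\<in>V. q J (x + (\<Sum>i\<in>J. (w + sgl j v) i)) = q J (x + (\<Sum>j\<in>J. w j))"
      by (intro bexI[of _ j] ballI) (simp_all only: sum_sgl[OF fin(3)[OF J]] if_False add_0_right)
  next
    fix J w assume "J \<in> \<L>" "w \<in> power_group V {..k}"
    then show "\<bar>q J (x + (\<Sum>j\<in>J. w j))\<bar> \<le> 1"
      using \<L>(1) by (intro q fin_subgroupD(3)[OF V x] hV) (auto simp: W_def)
  qed simp
  also have "\<dots> = avg W (\<lambda>y. avg W (\<lambda>h. g (x + (\<Sum>j\<in>I. h j)) y))"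
    unfolding g_def by (intro avg_cong prod.cong) (simp_all only: sum_restr[OF fin(1)] PowD add.assoc)
  \<comment> \<open>Shifting one edge of h in I adds \<open>y k\<close> to the base point. A shift
    of \<open>y k\<close> by -u then removes x and h from it; the edge sums use coordinates below k
    and do not change.\<close>
  also have "\<dots> = avg W (\<lambda>y. avg W (\<lambda>h. g (x + (\<Sum>j\<in>I. h j) + y k) y))"
  proof (rule avg_cong)
    fix y assume y: "y \<in> W"
    obtain j where j: "j \<in> I" using I(2) by auto
    have "sgl j (y k) \<in> W"
      unfolding W_def by (rule sgl_power_group[OF V]) (use y I j in \<open>auto simp: W_def power_group_def\<close>)
    from avg_translate[OF W this, of "\<lambda>h. g (x + (\<Sum>j\<in>I. h j)) y"]
    show "avg W (\<lambda>h. g (x + (\<Sum>j\<in>I. h j)) y) = avg W (\<lambda>h. g (x + (\<Sum>j\<in>I. h j) + y k) y)"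
      using j by (simp only: sum_sgl[OF fin(1)] if_True add.assoc)
  qed
  also have "\<dots> = avg W (\<lambda>h. avg W (\<lambda>y. g (x + (\<Sum>j\<in>I. h j) + y k) y))"
    by (rule avg_swap)
  also have "\<dots> = avg W (\<lambda>h. avg W (\<lambda>y. g (y k) y))"
  proof (rule avg_cong)
    fix h assume h: "h \<in> W"
    define u where "u = x + (\<Sum>j\<in>I. h j)"
    have "u \<in> V" unfolding u_def by (intro fin_subgroupD(3)[OF V x] hV h I)
    then have "sgl k (- u) \<in> W"
      unfolding W_def by (intro sgl_power_group[OF V]) (auto simp: fin_subgroupD[OF V])
    from avg_translate[OF W this, of "\<lambda>y. g (u + y k) y"]
    have "avg W (\<lambda>y. g (u + y k) y) = avg W (\<lambda>y. g (u + (y + sgl k (- u)) k) (y + sgl k (- u)))"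
      by (rule sym)
    also have "\<dots> = avg W (\<lambda>y. g (y k) y)"
    proof (rule avg_cong)
      fix y
      have "(\<Sum>i\<in>S. (y + sgl k (- u)) i) = (\<Sum>i\<in>S. y i)" if "S \<in> Pow I" for S
      proof -
        have "finite S" "k \<notin> S" using that fin(1) I(1) finite_subset by auto
        then show ?thesis by (simp only: sum_sgl if_False add_0_right)
      qed
      moreover have "u + (y + sgl k (- u)) k = y k" by (simp add: sgl_def)
      ultimately show "g (u + (y + sgl k (- u)) k) (y + sgl k (- u)) = g (y k) y"
        unfolding g_def by (intro prod.cong) (simp_all only:)
    qed
    finally have *: "avg W (\<lambda>y. g (u + y k) y) = avg W (\<lambda>y. g (y k) y)" .
    show "avg W (\<lambda>y. g (x + (\<Sum>j\<in>I. h j) + y k) y) = avg W (\<lambda>y. g (y k) y)"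
      by (rule *[unfolded u_def])
  qed
  also have "\<dots> = avg W (\<lambda>y. g (y k) y)" by (rule avg_const[OF W])
  finally show ?thesis unfolding W_def g_def .
qed

text \<open>Listing the index sets with every set before its proper subsets makes the replacement of
  the first phase by its derivatives, at the expense of the phases further down the list,
  terminate.\<close>

primrec down_list :: "nat \<Rightarrow> nat set list \<Rightarrow> bool" where
  "down_list k [] \<longleftrightarrow> True"
| "down_list k (I # L) \<longleftrightarrow> I \<subseteq> {..<k} \<and> (\<forall>J\<in>set L. \<not> I \<subseteq> J) \<and> (\<forall>J. J \<subset> I \<longrightarrow> J \<in> set L) \<and> down_list k L"

lemma down_list_Pow: "down_list k L \<Longrightarrow> set L \<subseteq> Pow {..<k}"
  by (induction L) auto

text \<open>A maximal member can be put in front of a down-closed family, and the rest is still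
  down-closed.\<close>

lemma down_list_exists: "\<exists>L. down_list k L \<and> set L = Pow {..<k}"
proof -
  have "\<exists>L. down_list k L \<and> set L = \<F>"
    if "\<F> \<subseteq> Pow {..<k}" "\<And>I J. I \<in> \<F> \<Longrightarrow> J \<subset> I \<Longrightarrow> J \<in> \<F>" "card \<F> = m" for \<F> m
    using that
  proof (induction m arbitrary: \<F>)
    case 0
    then have "\<F> = {}" using finite_subset[of \<F> "Pow {..<k}"] by simp
    then show ?case by (intro exI[of _ "[]"]) simp
  next
    case (Suc m)
    have fin: "finite \<F>" using Suc.prems(1) finite_subset by auto
    have "\<F> \<noteq> {}" using Suc.prems(3) by auto
    from finite_has_maximal[OF fin this] obtain I where I: "I \<in> \<F>" "\<And>J. J \<in> \<F> \<Longrightarrow> I \<subseteq> J \<Longrightarrow> I = J"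
      by blast
    have "\<exists>L. down_list k L \<and> set L = \<F> - {I}"
    proof (rule Suc.IH)
      show "\<F> - {I} \<subseteq> Pow {..<k}" using Suc.prems(1) by blast
      show "J \<in> \<F> - {I}" if "K \<in> \<F> - {I}" "J \<subset> K" for J K
        using that Suc.prems(2) I by blast
      show "card (\<F> - {I}) = m" using Suc.prems(3) I(1) by simp
    qed
    then obtain L where L: "down_list k L" "set L = \<F> - {I}" by blast
    have "down_list k (I # L)"
      using L I Suc.prems(1,2) by auto
    moreover have "set (I # L) = \<F>" using L(2) I(1) by auto
    ultimately show ?case by blast
  qed
  from this[of "Pow {..<k}"] show ?thesis by blast
qed

section \<open>Replacing one phase in a cube average by its derivatives\<close>

definition shifts_determine ::
  "'a::ab_group_add set \<Rightarrow> nat \<Rightarrow> nat set set \<Rightarrow> (nat set \<Rightarrow> 'a \<Rightarrow> real) \<Rightarrow> real \<Rightarrow> ('a \<Rightarrow> real) \<Rightarrow> bool" where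
  "shifts_determine V C \<J> q \<eta> \<psi> \<longleftrightarrow> (\<exists>A\<subseteq>V. card A \<le> C \<and> (\<forall>x\<in>V. \<forall>y\<in>V.
     (\<forall>J\<in>\<J>. \<forall>a\<in>A. q J (x + a) = q J (y + a)) \<longrightarrow> \<bar>\<psi> x - \<psi> y\<bar> \<le> \<eta>))"

text \<open>Two indices are tracked: r1 for the head of the list, the phase being worked off, and r
  for all phases. The induction lowers r1 while r may rise.\<close>

definition cube_avg_det :: "'a::ab_group_add itself \<Rightarrow> nat \<Rightarrow> nat set list \<Rightarrow> nat \<Rightarrow> nat \<Rightarrow> bool" where
  "cube_avg_det _ k L r1 r \<longleftrightarrow> (\<forall>\<eta>>0. \<exists>C. \<forall>(V::'a set) q. fin_subgroup V \<longrightarrow>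
     (\<forall>J\<in>set L. phase r V (q J)) \<longrightarrow> (L \<noteq> [] \<longrightarrow> phase r1 V (q (hd L))) \<longrightarrow>
     shifts_determine V C (set L) q \<eta> (cube_avg V k (set L) q))"

lemma cube_avg_detD:
  assumes "cube_avg_det TYPE('a::ab_group_add) k L r1 r" "\<eta> > 0"
  shows "\<exists>C. \<forall>(V::'a set) q. fin_subgroup V \<longrightarrow> (\<forall>J\<in>set L. phase r V (q J)) \<longrightarrow>
     (L \<noteq> [] \<longrightarrow> phase r1 V (q (hd L))) \<longrightarrow> shifts_determine V C (set L) q \<eta> (cube_avg V k (set L) q)"
  using assms unfolding cube_avg_det_def by simp

text \<open>The factor at vertex J when the cube phase of f is differentiated in direction a, a
  point of the power group whose coordinate k moves the base point.\<close>

definition dphase :: "('a::ab_group_add \<Rightarrow> real) \<Rightarrow> nat \<Rightarrow> (nat \<Rightarrow> 'a) \<Rightarrow> nat set \<Rightarrow> 'a \<Rightarrow> real" where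
  "dphase f k a J u = f (u + (a k + (\<Sum>j\<in>J. a j))) * f u"

text \<open>The cube phase of \<open>q I\<close> expresses \<open>q I\<close> through its values at the smaller vertices; \<open>reduced\<close>
  is what becomes of \<open>q\<close> when the cube phase is replaced by the product of its derivatives in the
  directions \<open>S\<close>, distributed over the vertices.\<close>

definition reduced :: "nat \<Rightarrow> nat set \<Rightarrow> (nat set \<Rightarrow> 'a::ab_group_add \<Rightarrow> real) \<Rightarrow> (nat \<Rightarrow> 'a) set \<Rightarrow> nat set \<Rightarrow> 'a \<Rightarrow> real" where
  "reduced k I q S J u =
    (if J = I then \<Prod>a\<in>S. dphase (q I) k a I u
     else if J \<subset> I then q J u * q I u * (\<Prod>a\<in>S. dphase (q I) k a J u) else q J u)"

text \<open>The last factor is a product of derivatives of the cube phase. Once a combination over S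
  of such products has been identified with the cube phase itself, the smaller vertices of
  \<open>q I\<close> cancel in squares and \<open>q I\<close> at its own vertex is restored.\<close>

lemma reduced_prod:
  assumes "finite I" "finite \<L>" "I \<notin> \<L>" "\<And>J. J \<subset> I \<Longrightarrow> J \<in> \<L>"
  shows "(\<Prod>J\<in>insert I \<L>. reduced k I q S J (u J)) =
    (\<Prod>J\<in>\<L>. q J (u J)) * (\<Prod>J\<in>Pow I - {I}. q I (u J)) * (\<Prod>a\<in>S. \<Prod>J\<in>Pow I. dphase (q I) k a J (u J))"
proof -
  define P where "P = Pow I - {I}"
  have P: "finite P" "P \<subseteq> \<L>" "I \<notin> P" "Pow I = insert I P"
    using assms by (auto simp: P_def)
  have "(\<Prod>J\<in>\<L>. reduced k I q S J (u J)) =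
      (\<Prod>J\<in>P. reduced k I q S J (u J)) * (\<Prod>J\<in>\<L> - P. reduced k I q S J (u J))"
    using prod.subset_diff[OF P(2) assms(2), of "\<lambda>J. reduced k I q S J (u J)"] by (simp add: mult.commute)
  also have "(\<Prod>J\<in>P. reduced k I q S J (u J)) =
      (\<Prod>J\<in>P. q J (u J) * q I (u J) * (\<Prod>a\<in>S. dphase (q I) k a J (u J)))"
    by (rule prod.cong) (auto simp: P_def reduced_def)
  also have "(\<Prod>J\<in>\<L> - P. reduced k I q S J (u J)) = (\<Prod>J\<in>\<L> - P. q J (u J))"
    by (rule prod.cong) (use assms(3) in \<open>auto simp: P_def reduced_def\<close>)
  finally have "(\<Prod>J\<in>\<L>. reduced k I q S J (u J)) =
      ((\<Prod>J\<in>P. q J (u J)) * (\<Prod>J\<in>\<L> - P. q J (u J))) * (\<Prod>J\<in>P. q I (u J)) *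
      (\<Prod>J\<in>P. \<Prod>a\<in>S. dphase (q I) k a J (u J))"
    by (simp add: prod.distrib mult_ac)
  also have "(\<Prod>J\<in>P. q J (u J)) * (\<Prod>J\<in>\<L> - P. q J (u J)) = (\<Prod>J\<in>\<L>. q J (u J))"
    using prod.subset_diff[OF P(2) assms(2), of "\<lambda>J. q J (u J)"] by (simp add: mult.commute)
  finally have *: "(\<Prod>J\<in>insert I \<L>. reduced k I q S J (u J)) =
      (\<Prod>J\<in>\<L>. q J (u J)) * (\<Prod>J\<in>P. q I (u J)) * (\<Prod>J\<in>Pow I. \<Prod>a\<in>S. dphase (q I) k a J (u J))"
    using assms P by (simp add: reduced_def mult_ac)
  show ?thesis
    by (subst prod.swap) (rule *[unfolded P_def])
qed

lemma phase_dphase: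
  assumes "fin_subgroup V" "a \<in> power_group V {..k}" "J \<subseteq> {..<k}" "phase (Suc r) V f"
  shows "phase r V (dphase f k a J)"
proof -
  have "(\<Sum>j\<in>J. a j) \<in> V"
    by (rule fin_subgroup_sum[OF assms(1)]) (use assms in \<open>auto simp: power_group_def\<close>)
  moreover have "a k \<in> V" using assms(2) by (auto simp: power_group_def)
  ultimately have "a k + (\<Sum>j\<in>J. a j) \<in> V" using fin_subgroupD(3)[OF assms(1)] by blast
  from phase_deriv[OF assms(1) this assms(4)] show ?thesis
    by (simp add: dphase_def[abs_def])
qed

text \<open>If the average is not uniformly small, the cube phase of \<open>q I\<close> is biased,
  hence a function of few of its derivatives. Expanding that function in products of signs turns the
  average into a bounded combination of averages of \<open>reduced\<close> families. There the phase
  at I, a product of derivatives, has dropped to index r1, while the smaller vertices have absorbed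
  copies of \<open>q I\<close>, whence \<open>max r (Suc r1)\<close>.\<close>

lemma cube_avg_det_step:
  fixes k :: nat
  assumes L: "down_list k (I # L)" and I: "I \<noteq> {}"
    and rk: "bias_rank TYPE(nat \<Rightarrow> 'a::ab_group_add) (Suc r1)"
    and IH: "cube_avg_det TYPE('a) k (I # L) r1 (max r (Suc r1))"
  shows "cube_avg_det TYPE('a) k (I # L) (Suc r1) r"
  unfolding cube_avg_det_def
proof (intro allI impI)
  fix \<eta> :: real assume \<eta>: "\<eta> > 0"
  \<comment> \<open>A value above \<open>\<eta> / 2\<close> becomes this bias after the 2^(card
    I)-th power in the Gowers-Cauchy-Schwarz bound.\<close>
  define \<epsilon> where "\<epsilon> = (\<eta> / 2) ^ (2 ^ card I)"
  have "\<epsilon> > 0" using \<eta> by (simp add: \<epsilon>_def)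
  from bias_rankD[OF rk this] obtain C0 where C0: "\<And>(W::(nat \<Rightarrow> 'a) set) f. fin_subgroup W \<Longrightarrow> phase (Suc r1) W f \<Longrightarrow>
     \<epsilon> \<le> \<bar>avg W f\<bar> \<Longrightarrow> derivs_determine W C0 f"
    by blast
  \<comment> \<open>The accuracy is shared among at most 2^C0 terms with coefficients at most
    1.\<close>
  have "\<eta> / 2 ^ C0 > 0" using \<eta> by simp
  from cube_avg_detD[OF IH this] obtain C1 where C1: "\<And>(V::'a set) q. fin_subgroup V \<Longrightarrow>
     (\<forall>J\<in>insert I (set L). phase (max r (Suc r1)) V (q J)) \<Longrightarrow> phase r1 V (q I) \<Longrightarrow>
     shifts_determine V C1 (insert I (set L)) q (\<eta> / 2 ^ C0) (cube_avg V k (insert I (set L)) q)"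
    by auto
  \<comment> \<open>Each of at most 2^C0 subsets S needs C1 shifts. At a shifted point
    \<open>reduced\<close> is read off from q there and from \<open>q I\<close> at the translates by
    at most C0 * 2^(card I) directions of derivatives.\<close>
  define C where "C = 2 ^ C0 * C1 * (1 + C0 * 2 ^ card I)"
  have finI: "finite I" and Ik: "I \<subseteq> {..<k}" and IL: "I \<notin> set L"
    and sub: "\<And>J. J \<subset> I \<Longrightarrow> J \<in> set L" and Lk: "set L \<subseteq> Pow {..<k}"
    and nsub: "\<And>J. J \<in> set L \<Longrightarrow> \<not> I \<subseteq> J"
    using L down_list_Pow[of k L] finite_subset[of I "{..<k}"] by auto
  show "\<exists>C. \<forall>(V::'a set) q. fin_subgroup V \<longrightarrow>
     (\<forall>J\<in>set (I # L). phase r V (q J)) \<longrightarrow> (I # L \<noteq> [] \<longrightarrow> phase (Suc r1) V (q (hd (I # L)))) \<longrightarrow>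
     shifts_determine V C (set (I # L)) q \<eta> (cube_avg V k (set (I # L)) q)"
  proof (intro exI[of _ C] allI impI)
    fix V :: "'a set" and q
    assume V: "fin_subgroup V" and q: "\<forall>J\<in>set (I # L). phase r V (q J)"
      and "I # L \<noteq> [] \<longrightarrow> phase (Suc r1) V (q (hd (I # L)))"
    then have qI: "phase (Suc r1) V (q I)" by simp
    have qabs: "\<bar>q J x\<bar> = 1" if "J \<in> insert I (set L)" "x \<in> V" for J x
      using q that by (intro phase_abs) auto
    define W where "W = power_group V {..k}"
    have W: "fin_subgroup W" unfolding W_def by (rule fin_subgroup_power_group[OF V]) simp
    have hV: "(\<Sum>j\<in>J. h j) \<in> V" if "h \<in> W" "J \<subseteq> {..<k}" for h J
      by (rule fin_subgroup_sum[OF V]) (use that in \<open>auto simp: W_def power_group_def\<close>)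
    have hk: "h k \<in> V" if "h \<in> W" for h using that by (auto simp: W_def power_group_def)
    define \<psi> where "\<psi> = cube_avg V k (insert I (set L)) q"
    define G where "G w = (\<Prod>J\<in>Pow I. q I (w k + (\<Sum>j\<in>J. w j)))" for w
    have "shifts_determine V C (insert I (set L)) q \<eta> \<psi>"
    proof (cases "\<forall>x\<in>V. \<bar>\<psi> x\<bar> \<le> \<eta> / 2")
      case True
      have "\<bar>\<psi> x - \<psi> y\<bar> \<le> \<eta>" if "x \<in> V" "y \<in> V" for x y
        using True[rule_format, OF that(1)] True[rule_format, OF that(2)] by linarith
      then show ?thesis unfolding shifts_determine_def by (intro exI[of _ "{}"]) simp
    next
      case False
      then obtain x0 where x0: "x0 \<in> V" "\<eta> / 2 < \<bar>\<psi> x0\<bar>" by force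
      have "\<epsilon> \<le> \<bar>\<psi> x0\<bar> ^ (2 ^ card I)"
        unfolding \<epsilon>_def using x0 \<eta> by (intro power_mono) auto
      also have "\<dots> = \<psi> x0 ^ (2 ^ card I)"
        using I finI by (intro power_even_abs) auto
      also have "\<dots> \<le> avg W G"
        unfolding \<psi>_def W_def G_def
        by (rule cube_avg_le_cube_bias[OF V Ik I Lk nsub _ x0(1)]) (auto simp: qabs)
      finally have "\<epsilon> \<le> \<bar>avg W G\<bar>" by linarith
      moreover have G: "phase (Suc r1) W G"
        unfolding G_def
      proof (rule phase_prod[OF W])
        fix J assume "J \<in> Pow I"
        then have J: "J \<subseteq> {..<k}" using Ik by auto
        show "phase (Suc r1) W (\<lambda>w. q I (w k + (\<Sum>j\<in>J. w j)))"
          by (rule phase_comp[OF _ _ W qI]) (auto simp: J hV hk fin_subgroupD(3)[OF V] sum.distrib)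
      qed
      ultimately have "derivs_determine W C0 G" by (intro C0[OF W])
      then obtain A' where A': "A' \<subseteq> W" "card A' \<le> C0" and
          "\<forall>x\<in>W. \<forall>y\<in>W. (\<forall>a\<in>A'. G (x + a) * G x = G (y + a) * G y) \<longrightarrow> G x = G y"
        unfolding derivs_determine_def by (elim exE conjE)
      note det = this(3)[THEN bspec, THEN bspec, THEN mp]
      have finA': "finite A'" using A'(1) fin_subgroupD(1)[OF W] finite_subset by blast
      have Gpm: "G w = 1 \<or> G w = -1" if "w \<in> W" for w using phase_pm[OF G that] .
      have "\<exists>\<gamma>. (\<forall>S. \<bar>\<gamma> S\<bar> \<le> 1 \<and> \<gamma> S * 2 ^ (0 + card A') \<in> \<int>) \<and>
          (\<forall>w\<in>W. G w = (\<Sum>S\<in>Pow A'. \<gamma> S * (\<Prod>a\<in>S. G (w + a) * G w)))"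
      proof (rule sign_fourier[OF finA'])
        show "G (w + a) * G w = 1 \<or> G (w + a) * G w = - 1" if "a \<in> A'" "w \<in> W" for a w
          using Gpm[OF that(2)] Gpm[OF fin_subgroupD(3)[OF W that(2)], of a] A'(1) that by auto
        show "\<bar>G w\<bar> \<le> 1" "G w * 2 ^ 0 \<in> \<int>" if "w \<in> W" for w
          using Gpm[OF that] by auto
      qed (rule det, auto)
      then obtain \<gamma> where \<gamma>: "\<And>S. \<bar>\<gamma> S\<bar> \<le> 1"
        "\<And>w. w \<in> W \<Longrightarrow> G w = (\<Sum>S\<in>Pow A'. \<gamma> S * (\<Prod>a\<in>S. G (w + a) * G w))"
        by blast
      have expand: "(\<Prod>J\<in>insert I (set L). q J (x + (\<Sum>j\<in>J. h j))) =
          (\<Sum>S\<in>Pow A'. \<gamma> S * (\<Prod>J\<in>insert I (set L). reduced k I q S J (x + (\<Sum>j\<in>J. h j))))"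
        if x: "x \<in> V" and h: "h \<in> W" for x h
      proof -
        define u where "u J = x + (\<Sum>j\<in>J. h j)" for J
        \<comment> \<open>Coordinate k takes the base point, so the cube at x with edges h becomes a
          point of W at which \<open>G\<close> can be evaluated.\<close>
        define w where "w = h(k := x)"
        have w: "w \<in> W" using h x by (auto simp: w_def W_def power_group_def)
        have wJ: "w k + (\<Sum>j\<in>J. w j) = u J" if "J \<in> Pow I" for J
        proof -
          have "k \<notin> J" using that Ik by auto
          then show ?thesis unfolding w_def u_def by (auto intro!: sum.cong)
        qed
        have uV: "u J \<in> V" if "J \<in> Pow I" for J
          unfolding u_def using that Ik by (intro fin_subgroupD(3)[OF V x] hV[OF h]) auto
        have Gw: "G w = (\<Prod>J\<in>Pow I. q I (u J))"
          unfolding G_def by (rule prod.cong) (simp_all add: wJ)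
        have Gwa: "G (w + a) * G w = (\<Prod>J\<in>Pow I. dphase (q I) k a J (u J))" for a
          unfolding G_def prod.distrib[symmetric] dphase_def
          by (rule prod.cong) (simp_all add: wJ[symmetric] sum.distrib add_ac)
        have "(\<Sum>S\<in>Pow A'. \<gamma> S * (\<Prod>J\<in>insert I (set L). reduced k I q S J (u J))) =
           (\<Prod>J\<in>set L. q J (u J)) * (\<Prod>J\<in>Pow I - {I}. q I (u J)) *
           (\<Sum>S\<in>Pow A'. \<gamma> S * (\<Prod>a\<in>S. G (w + a) * G w))"
          unfolding Gwa
          by (subst reduced_prod[OF finI _ IL sub]) (simp_all add: sum_distrib_left mult_ac)
        also have "\<dots> = (\<Prod>J\<in>set L. q J (u J)) * (\<Prod>J\<in>Pow I - {I}. q I (u J)) * (\<Prod>J\<in>Pow I. q I (u J))"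
          using \<gamma>(2)[OF w] Gw by simp
        also have "(\<Prod>J\<in>Pow I. q I (u J)) = q I (u I) * (\<Prod>J\<in>Pow I - {I}. q I (u J))"
          using finI by (intro prod.remove) auto
        also have "(\<Prod>J\<in>set L. q J (u J)) * (\<Prod>J\<in>Pow I - {I}. q I (u J)) *
            (q I (u I) * (\<Prod>J\<in>Pow I - {I}. q I (u J))) =
            (\<Prod>J\<in>insert I (set L). q J (u J)) * (\<Prod>J\<in>Pow I - {I}. q I (u J) * q I (u J))"
          using IL by (simp add: prod.distrib mult_ac)
        also have "(\<Prod>J\<in>Pow I - {I}. q I (u J) * q I (u J)) = 1"
          by (rule prod.neutral) (use phase_sq[OF qI uV] in auto)
        finally show ?thesis unfolding u_def by simp
      qed
      have \<psi>: "\<psi> x = (\<Sum>S\<in>Pow A'. \<gamma> S * cube_avg V k (insert I (set L)) (reduced k I q S) x)" if "x \<in> V" for x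
      proof -
        have "\<psi> x = avg W (\<lambda>h. \<Sum>S\<in>Pow A'. \<gamma> S * (\<Prod>J\<in>insert I (set L). reduced k I q S J (x + (\<Sum>j\<in>J. h j))))"
          unfolding \<psi>_def cube_avg_def W_def[symmetric] by (rule avg_cong) (rule expand[OF that])
        then show ?thesis unfolding cube_avg_def W_def avg_sum avg_cmult .
      qed
      have "shifts_determine V C1 (insert I (set L)) (reduced k I q S) (\<eta> / 2 ^ C0)
          (cube_avg V k (insert I (set L)) (reduced k I q S))"
        if S: "S \<in> Pow A'" for S
      proof (rule C1[OF V], rule ballI)
        have dp: "phase r1 V (dphase (q I) k a J)" if "a \<in> S" "J \<subseteq> I" for a J
          by (rule phase_dphase[OF V _ _ qI]) (use that S A'(1) Ik in \<open>auto simp: W_def\<close>)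
        have redI: "reduced k I q S I = (\<lambda>u. \<Prod>a\<in>S. dphase (q I) k a I u)"
          by (simp add: reduced_def fun_eq_iff)
        show rI: "phase r1 V (reduced k I q S I)"
          unfolding redI by (rule phase_prod[OF V dp]) auto
        let ?m = "max r (Suc r1)"
        fix J assume J: "J \<in> insert I (set L)"
        have "phase r V (q J)" using q J by auto
        then have qJ: "phase ?m V (q J)" by (rule phase_mono[OF V]) simp
        have qIm: "phase ?m V (q I)" by (rule phase_mono[OF V qI]) simp
        consider "J = I" | "J \<subset> I" | "J \<noteq> I" "\<not> J \<subset> I" by blast
        then show "phase ?m V (reduced k I q S J)"
        proof cases
          case 1
          then show ?thesis using phase_mono[OF V rI, of ?m] by simp
        next
          case 2
          have "reduced k I q S J = (\<lambda>u. q J u * q I u * (\<Prod>a\<in>S. dphase (q I) k a J u))"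
            using 2 by (auto simp: reduced_def fun_eq_iff)
          moreover have "phase ?m V (\<lambda>u. \<Prod>a\<in>S. dphase (q I) k a J u)"
            by (rule phase_mono[OF V phase_prod[OF V dp]]) (use 2 in auto)
          ultimately show ?thesis
            using phase_mult[OF V phase_mult[OF V qJ qIm]] by simp
        next
          case 3
          then show ?thesis using qJ by (simp add: reduced_def[abs_def])
        qed
      qed
      then have "\<exists>A. A \<subseteq> V \<and> card A \<le> C1 \<and> (\<forall>x\<in>V. \<forall>y\<in>V.
          (\<forall>J\<in>insert I (set L). \<forall>a\<in>A. reduced k I q S J (x + a) = reduced k I q S J (y + a)) \<longrightarrow>
          \<bar>cube_avg V k (insert I (set L)) (reduced k I q S) x -
            cube_avg V k (insert I (set L)) (reduced k I q S) y\<bar> \<le> \<eta> / 2 ^ C0)" if "S \<in> Pow A'" for S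
        using that unfolding shifts_determine_def by simp
      then obtain AS where AS: "\<And>S. S \<in> Pow A' \<Longrightarrow> AS S \<subseteq> V \<and> card (AS S) \<le> C1 \<and> (\<forall>x\<in>V. \<forall>y\<in>V.
          (\<forall>J\<in>insert I (set L). \<forall>a\<in>AS S. reduced k I q S J (x + a) = reduced k I q S J (y + a)) \<longrightarrow>
          \<bar>cube_avg V k (insert I (set L)) (reduced k I q S) x -
            cube_avg V k (insert I (set L)) (reduced k I q S) y\<bar> \<le> \<eta> / 2 ^ C0)"
        by metis
      define B where "B = (\<Union>S\<in>Pow A'. AS S)"
      define D where "D = (\<lambda>(a, J). a k + (\<Sum>j\<in>J. a j)) ` (A' \<times> Pow I)"
      define A where "A = (\<lambda>(b, c). b + c) ` (B \<times> insert 0 D)"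
      have BV: "B \<subseteq> V" using AS by (auto simp: B_def)
      have "a k + (\<Sum>j\<in>J. a j) \<in> V" if "a \<in> A'" "J \<subseteq> I" for a J
        by (rule fin_subgroupD(3)[OF V hk hV]) (use that A'(1) Ik in auto)
      then have DV: "D \<subseteq> V" by (auto simp: D_def)
      have "A \<subseteq> V" using BV DV fin_subgroupD(2,3)[OF V] by (auto simp: A_def)
      have finB: "finite B" and finD: "finite D"
        using BV DV fin_subgroupD(1)[OF V] finite_subset by blast+
      have "card B \<le> (\<Sum>S\<in>Pow A'. card (AS S))"
        unfolding B_def by (rule card_UN_le) (use finA' in simp)
      also have "\<dots> \<le> card (Pow A') * C1"
        using AS sum_bounded_above[of "Pow A'" "\<lambda>S. card (AS S)" C1] by simp
      also have "\<dots> \<le> 2 ^ C0 * C1"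
        using finA' A'(2) by (simp add: card_Pow)
      finally have cB: "card B \<le> 2 ^ C0 * C1" .
      have "card D \<le> card (A' \<times> Pow I)"
        unfolding D_def by (rule card_image_le) (use finA' finI in simp)
      also have "\<dots> \<le> C0 * 2 ^ card I"
        using A'(2) finI by (simp add: card_cartesian_product card_Pow)
      finally have cD: "card (insert 0 D) \<le> 1 + C0 * 2 ^ card I"
        using card_insert_le_m1[of "Suc (C0 * 2 ^ card I)" D 0] by simp
      have "card A \<le> card (B \<times> insert 0 D)"
        unfolding A_def by (rule card_image_le) (use finB finD in simp)
      also have "\<dots> \<le> C"
        unfolding C_def card_cartesian_product by (rule mult_le_mono[OF cB cD])
      finally have cA: "card A \<le> C" .
      have bound: "\<bar>\<psi> x - \<psi> y\<bar> \<le> \<eta>" if x: "x \<in> V" and y: "y \<in> V"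
        and eq: "\<And>J a. J \<in> insert I (set L) \<Longrightarrow> a \<in> A \<Longrightarrow> q J (x + a) = q J (y + a)" for x y
      proof -
        have eq0: "q J (x + b) = q J (y + b)" if "J \<in> insert I (set L)" "b \<in> B" for J b
          by (rule eq[OF that(1)]) (use that(2) in \<open>force simp: A_def\<close>)
        have eqd: "dphase (q I) k a J (x + b) = dphase (q I) k a J (y + b)"
          if "b \<in> B" "a \<in> A'" "J \<subseteq> I" for a b J
        proof -
          have "b + (a k + (\<Sum>j\<in>J. a j)) \<in> A" using that by (force simp: A_def D_def)
          then have "q I (x + (b + (a k + (\<Sum>j\<in>J. a j)))) = q I (y + (b + (a k + (\<Sum>j\<in>J. a j))))"
            by (intro eq) auto
          then show ?thesis using eq0[of I b] that(1) by (simp add: dphase_def add.assoc)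
        qed
        have "\<bar>cube_avg V k (insert I (set L)) (reduced k I q S) x - cube_avg V k (insert I (set L)) (reduced k I q S) y\<bar> \<le> \<eta> / 2 ^ C0"
          if S: "S \<in> Pow A'" for S
        proof (rule conjunct2[OF conjunct2[OF AS[OF S]], rule_format, OF x y])
          fix J b assume J: "J \<in> insert I (set L)" and "b \<in> AS S"
          then have b: "b \<in> B" using S by (auto simp: B_def)
          have "(\<Prod>a\<in>S. dphase (q I) k a J (x + b)) = (\<Prod>a\<in>S. dphase (q I) k a J (y + b))" if "J \<subseteq> I"
            by (rule prod.cong) (use eqd b that S in auto)
          then show "reduced k I q S J (x + b) = reduced k I q S J (y + b)"
            using eq0[OF J b] eq0[of I b] b by (auto simp: reduced_def)
        qed
        then have "\<bar>\<gamma> S * cube_avg V k (insert I (set L)) (reduced k I q S) x -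
            \<gamma> S * cube_avg V k (insert I (set L)) (reduced k I q S) y\<bar> \<le> \<eta> / 2 ^ C0"
          if S: "S \<in> Pow A'" for S
          using mult_mono[OF \<gamma>(1)[of S] , of "\<bar>cube_avg V k (insert I (set L)) (reduced k I q S) x - cube_avg V k (insert I (set L)) (reduced k I q S) y\<bar>" "\<eta> / 2 ^ C0"] S
          by (simp add: abs_mult flip: right_diff_distrib)
        then have "(\<Sum>S\<in>Pow A'. \<bar>\<gamma> S * cube_avg V k (insert I (set L)) (reduced k I q S) x -
            \<gamma> S * cube_avg V k (insert I (set L)) (reduced k I q S) y\<bar>) \<le> of_nat (card (Pow A')) * (\<eta> / 2 ^ C0)"
          by (rule sum_bounded_above)
        also have "\<dots> \<le> 2 ^ C0 * (\<eta> / 2 ^ C0)"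
          using \<eta> A'(2) finA' by (intro mult_right_mono) (simp_all add: card_Pow)
        also have "\<dots> = \<eta>" by simp
        finally show ?thesis
          unfolding \<psi>[OF x] \<psi>[OF y] sum_subtractf[symmetric]
          by (rule order_trans[OF sum_abs])
      qed
      show ?thesis
        unfolding shifts_determine_def
      proof (intro exI[of _ A] conjI ballI impI)
        fix x y assume "x \<in> V" "y \<in> V" "\<forall>J\<in>insert I (set L). \<forall>a\<in>A. q J (x + a) = q J (y + a)"
        then show "\<bar>\<psi> x - \<psi> y\<bar> \<le> \<eta>" by (intro bound) auto
      qed (use \<open>A \<subseteq> V\<close> cA in simp_all)
    qed
    then show "shifts_determine V C (set (I # L)) q \<eta> (cube_avg V k (set (I # L)) q)"
      unfolding \<psi>_def by simp
  qed
qed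

text \<open>The recursion is lexicographic, in the list and then in the index of its head; r may
  rise, but never beyond d. A head of index 0 is constantly 1 and is struck off, after which the
  next head is only known to have index r.\<close>

lemma cube_avg_det_all:
  assumes rk: "\<And>s. s \<le> d \<Longrightarrow> bias_rank TYPE(nat \<Rightarrow> 'a::ab_group_add) s"
  shows "down_list k L \<Longrightarrow> r \<le> d \<Longrightarrow> r1 \<le> d \<Longrightarrow> cube_avg_det TYPE('a) k L r1 r"
proof (induction L arbitrary: r1 r)
  case Nil
  show ?case unfolding cube_avg_det_def cube_avg_def shifts_determine_def
    by (auto intro!: exI[of _ 0] exI[of _ "{}"])
next
  case (Cons I L)
  show ?case
  proof (cases "I = {}")
    case True
    \<comment> \<open>The empty set lies in every set, so nothing can follow it in a
      \<open>down_list\<close>. What is left is \<open>q {}\<close>, for which the shift 0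
      suffices.\<close>
    then have L: "L = []" using Cons.prems(1) by (cases L) auto
    have "cube_avg V k {{}} q x = q {} x" if "fin_subgroup V" for V :: "'a set" and q x
      using avg_const[OF fin_subgroup_power_group[OF that finite_atMost[of k]]] by (simp add: cube_avg_def)
    then show ?thesis unfolding cube_avg_det_def shifts_determine_def L True
      by (intro allI impI exI[of _ 1] exI[of _ "{0}"]) (auto simp: fin_subgroupD(2))
  next
    case False
    show ?thesis
      using Cons.prems(2,3)
    proof (induction r1 arbitrary: r)
      case 0
      have L: "cube_avg_det TYPE('a) k L r r"
        using Cons.IH Cons.prems(1) 0 by simp
      have finI: "finite I" and Ik: "I \<subseteq> {..<k}" and IL: "I \<notin> set L"
        using Cons.prems(1) finite_subset[of I "{..<k}"] by auto
      show ?case unfolding cube_avg_det_def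
      proof (intro allI impI)
        fix \<eta> :: real assume \<eta>: "\<eta> > 0"
        from cube_avg_detD[OF L this] obtain C where C: "\<And>(V::'a set) q. fin_subgroup V \<Longrightarrow>
           (\<forall>J\<in>set L. phase r V (q J)) \<Longrightarrow> (L \<noteq> [] \<longrightarrow> phase r V (q (hd L))) \<Longrightarrow>
           shifts_determine V C (set L) q \<eta> (cube_avg V k (set L) q)"
          by blast
        show "\<exists>C. \<forall>(V::'a set) q. fin_subgroup V \<longrightarrow>
           (\<forall>J\<in>set (I # L). phase r V (q J)) \<longrightarrow> (I # L \<noteq> [] \<longrightarrow> phase 0 V (q (hd (I # L)))) \<longrightarrow>
           shifts_determine V C (set (I # L)) q \<eta> (cube_avg V k (set (I # L)) q)"
        proof (intro exI[of _ C] allI impI)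
          fix V :: "'a set" and q
          assume V: "fin_subgroup V" and q: "\<forall>J\<in>set (I # L). phase r V (q J)"
            and "I # L \<noteq> [] \<longrightarrow> phase 0 V (q (hd (I # L)))"
          then have q1: "\<And>x. x \<in> V \<Longrightarrow> q I x = 1" by simp
          have eq: "cube_avg V k (set (I # L)) q x = cube_avg V k (set L) q x" if x: "x \<in> V" for x
            unfolding cube_avg_def
          proof (rule avg_cong)
            fix h assume h: "h \<in> power_group V {..k}"
            have "(\<Sum>j\<in>I. h j) \<in> V"
              by (rule fin_subgroup_sum[OF V]) (use h Ik in \<open>auto simp: power_group_def\<close>)
            then have "q I (x + (\<Sum>j\<in>I. h j)) = 1"
              by (intro q1 fin_subgroupD(3)[OF V x])
            then show "(\<Prod>J\<in>set (I # L). q J (x + (\<Sum>j\<in>J. h j))) = (\<Prod>J\<in>set L. q J (x + (\<Sum>j\<in>J. h j)))"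
              using IL by simp
          qed
          have "shifts_determine V C (set L) q \<eta> (cube_avg V k (set L) q)"
            by (rule C[OF V]) (use q in auto)
          then obtain A where A: "A \<subseteq> V" "card A \<le> C" "\<forall>x\<in>V. \<forall>y\<in>V.
              (\<forall>J\<in>set L. \<forall>a\<in>A. q J (x + a) = q J (y + a)) \<longrightarrow>
              \<bar>cube_avg V k (set L) q x - cube_avg V k (set L) q y\<bar> \<le> \<eta>"
            unfolding shifts_determine_def by (elim exE conjE)
          show "shifts_determine V C (set (I # L)) q \<eta> (cube_avg V k (set (I # L)) q)"
            unfolding shifts_determine_def
          proof (intro exI[of _ A] conjI ballI impI A(1,2))
            fix x y assume "x \<in> V" "y \<in> V" "\<forall>J\<in>set (I # L). \<forall>a\<in>A. q J (x + a) = q J (y + a)"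
            then show "\<bar>cube_avg V k (set (I # L)) q x - cube_avg V k (set (I # L)) q y\<bar> \<le> \<eta>"
              using A(3) eq by simp
          qed
        qed
      qed
    next
      case (Suc r1)
      then show ?case
        by (intro cube_avg_det_step[OF Cons.prems(1) False rk]) auto
    qed
  qed
qed

section \<open>Biased phase polynomials have bounded rank\<close>

text \<open>The edge sum over a nonempty J contains a uniform edge. To use this, one edge in J is
  translated by an auxiliary v, and v is averaged first.\<close>

lemma avg_cube_vertex:
  assumes V: "fin_subgroup V" and J: "J \<subseteq> {..<k}" "J \<noteq> {}" and x: "x \<in> V"
  shows "avg (power_group V {..k}) (\<lambda>h. g (x + (\<Sum>j\<in>J. h j))) = avg V g"
proof -
  define W where "W = power_group V {..k}"
  have W: "fin_subgroup W" unfolding W_def by (rule fin_subgroup_power_group[OF V]) simp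
  have finJ: "finite J" using J finite_subset by blast
  obtain j where j: "j \<in> J" using J(2) by auto
  have "avg W (\<lambda>h. g (x + (\<Sum>j\<in>J. h j))) = avg V (\<lambda>v. avg W (\<lambda>h. g (x + (\<Sum>j\<in>J. h j))))"
    by (rule avg_const[OF V, symmetric])
  also have "\<dots> = avg V (\<lambda>v. avg W (\<lambda>h. g (v + (x + (\<Sum>j\<in>J. h j)))))"
  proof (rule avg_cong)
    fix v assume "v \<in> V"
    then have "sgl j v \<in> W"
      unfolding W_def by (intro sgl_power_group[OF V]) (use J j in auto)
    from avg_translate[OF W this, of "\<lambda>h. g (x + (\<Sum>j\<in>J. h j))"]
    show "avg W (\<lambda>h. g (x + (\<Sum>j\<in>J. h j))) = avg W (\<lambda>h. g (v + (x + (\<Sum>j\<in>J. h j))))"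
      using j by (simp only: sum_sgl[OF finJ] if_True ac_simps)
  qed
  also have "\<dots> = avg W (\<lambda>h. avg V (\<lambda>v. g (v + (x + (\<Sum>j\<in>J. h j)))))"
    by (rule avg_swap)
  also have "\<dots> = avg W (\<lambda>h. avg V g)"
  proof (rule avg_cong, rule avg_translate[OF V])
    fix h assume "h \<in> W"
    then show "x + (\<Sum>j\<in>J. h j) \<in> V"
      using J by (intro fin_subgroupD(3)[OF V x] fin_subgroup_sum[OF V]) (auto simp: W_def power_group_def)
  qed
  also have "\<dots> = avg V g" by (rule avg_const[OF W])
  finally show ?thesis unfolding W_def .
qed

text \<open>Factors are exchanged one at a time; A is only bounded by M, so each exchange may cost a
  factor M.\<close>

lemma prod_diff_bound:
  fixes A B :: "'b \<Rightarrow> real"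
  assumes M: "M \<ge> 1" and "finite N"
  shows "(\<And>J. J \<in> N \<Longrightarrow> \<bar>A J\<bar> \<le> M) \<Longrightarrow> (\<And>J. J \<in> N \<Longrightarrow> \<bar>B J\<bar> \<le> 1) \<Longrightarrow>
    \<bar>(\<Prod>J\<in>N. A J) - (\<Prod>J\<in>N. B J)\<bar> \<le> M ^ card N * (\<Sum>J\<in>N. \<bar>A J - B J\<bar>)"
  using assms(2)
proof (induction N rule: finite_induct)
  case (insert I N)
  let ?a = "\<Prod>J\<in>N. A J" and ?b = "\<Prod>J\<in>N. B J"
  have b: "\<bar>?b\<bar> \<le> 1"
    unfolding abs_prod by (rule prod_le_1) (use insert.prems in auto)
  have "\<bar>A I * ?a - B I * ?b\<bar> = \<bar>A I * (?a - ?b) + (A I - B I) * ?b\<bar>"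
    by (simp add: algebra_simps)
  also have "\<dots> \<le> \<bar>A I\<bar> * \<bar>?a - ?b\<bar> + \<bar>A I - B I\<bar> * \<bar>?b\<bar>"
    unfolding abs_mult[symmetric] by (rule abs_triangle_ineq)
  also have "\<dots> \<le> M * (M ^ card N * (\<Sum>J\<in>N. \<bar>A J - B J\<bar>)) + M ^ Suc (card N) * \<bar>A I - B I\<bar>"
  proof (rule add_mono)
    show "\<bar>A I\<bar> * \<bar>?a - ?b\<bar> \<le> M * (M ^ card N * (\<Sum>J\<in>N. \<bar>A J - B J\<bar>))"
      by (rule mult_mono) (use insert M in auto)
    have "\<bar>A I - B I\<bar> * \<bar>?b\<bar> \<le> \<bar>A I - B I\<bar> * M ^ Suc (card N)"
      using b one_le_power[OF M, of "Suc (card N)"] by (intro mult_left_mono) auto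
    then show "\<bar>A I - B I\<bar> * \<bar>?b\<bar> \<le> M ^ Suc (card N) * \<bar>A I - B I\<bar>"
      by (simp add: mult.commute)
  qed
  also have "\<dots> = M ^ card (insert I N) * (\<Sum>J\<in>insert I N. \<bar>A J - B J\<bar>)"
    using insert.hyps by (simp add: algebra_simps)
  finally show ?case using insert.hyps by simp
qed simp

text \<open>Since \<open>f(z + a) f(z)\<close> averages to \<open>b f(z)\<close> over \<open>a\<close>, the deviation of a sum of samples
  behaves like that of independent variables; the samples are chosen greedily.\<close>

lemma sample_derivatives:
  assumes V: "fin_subgroup V" and f: "\<And>x. x \<in> V \<Longrightarrow> f x * f x = (1::real)"
  shows "\<exists>a. (\<forall>i. a i \<in> V) \<and>
    avg V (\<lambda>z. (\<Sum>i<m. f (z + a i) * f z - avg V f * f z)\<^sup>2) \<le> real m"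
proof (induction m)
  case 0
  show ?case using fin_subgroupD(2)[OF V] by (intro exI[of _ "\<lambda>_. 0"]) (simp add: avg_const[OF V])
next
  case (Suc m)
  define b where "b = avg V f"
  from Suc obtain a where a: "\<And>i. a i \<in> V"
    "avg V (\<lambda>z. (\<Sum>i<m. f (z + a i) * f z - b * f z)\<^sup>2) \<le> real m"
    unfolding b_def by blast
  define S where "S z = (\<Sum>i<m. f (z + a i) * f z - b * f z)" for z
  \<comment> \<open>Over a random candidate c the cross term has mean 0 and the new term has
    variance 1 - b^2. Some c does at least as well as the average.\<close>
  have "avg V (\<lambda>c. avg V (\<lambda>z. (S z + (f (z + c) * f z - b * f z))\<^sup>2)) =
      avg V (\<lambda>z. avg V (\<lambda>c. (S z + (f (z + c) * f z - b * f z))\<^sup>2))"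
    by (rule avg_swap)
  also have "\<dots> \<le> avg V (\<lambda>z. (S z)\<^sup>2 + 1)"
  proof (rule avg_mono)
    fix z assume z: "z \<in> V"
    have "avg V (\<lambda>c. (S z + (f (z + c) * f z - b * f z))\<^sup>2) =
        avg V (\<lambda>c. (2 * S z * f z - 2 * b) * f (z + c) + ((S z)\<^sup>2 - 2 * S z * f z * b + 1 + b\<^sup>2))"
    proof (rule avg_cong)
      fix c assume "c \<in> V"
      then have zc: "f (z + c) * f (z + c) = 1" using f fin_subgroupD(3)[OF V z] by blast
      have "(S z + (f (z + c) * f z - b * f z))\<^sup>2 =
          (S z)\<^sup>2 + 2 * S z * f z * f (z + c) - 2 * S z * f z * b
          + (f z * f z) * (f (z + c) * f (z + c)) - 2 * b * (f z * f z) * f (z + c) + b\<^sup>2 * (f z * f z)"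
        by (simp add: power2_eq_square algebra_simps)
      then show "(S z + (f (z + c) * f z - b * f z))\<^sup>2 =
          (2 * S z * f z - 2 * b) * f (z + c) + ((S z)\<^sup>2 - 2 * S z * f z * b + 1 + b\<^sup>2)"
        unfolding zc f[OF z] by (simp add: algebra_simps)
    qed
    also have "\<dots> = (2 * S z * f z - 2 * b) * b + ((S z)\<^sup>2 - 2 * S z * f z * b + 1 + b\<^sup>2)"
    proof -
      have "avg V (\<lambda>c. f (z + c)) = b"
        unfolding b_def using avg_translate[OF V z, of f] by (simp add: add.commute)
      then show ?thesis by (simp only: avg_add avg_cmult avg_const[OF V])
    qed
    also have "\<dots> = (S z)\<^sup>2 + 1 - b\<^sup>2" by (simp add: power2_eq_square algebra_simps)
    finally show "avg V (\<lambda>c. (S z + (f (z + c) * f z - b * f z))\<^sup>2) \<le> (S z)\<^sup>2 + 1" by simp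
  qed
  also have "\<dots> \<le> real (Suc m)"
    using a(2) by (simp add: avg_add avg_const[OF V] S_def)
  finally obtain c where c: "c \<in> V"
    "avg V (\<lambda>z. (S z + (f (z + c) * f z - b * f z))\<^sup>2) \<le> real (Suc m)"
    using avg_exists_le[OF V] by blast
  have "(\<Sum>i<Suc m. f (z + (a(m := c)) i) * f z - b * f z) = S z + (f (z + c) * f z - b * f z)" for z
    unfolding S_def sum.lessThan_Suc by (intro arg_cong2[where f="(+)"] sum.cong) auto
  then show ?case
    unfolding b_def[symmetric] using a(1) c by (intro exI[of _ "a(m := c)"]) auto
qed

text \<open>The sample mean of m derivatives, divided by the bias b, estimates f with mean square
  error at most 1/(m b^2). A square number of samples makes the root of this bound explicit.\<close>

lemma sample_approximation:
  assumes V: "fin_subgroup V" and f: "\<And>x. x \<in> V \<Longrightarrow> f x * f x = (1::real)" and b: "avg V f \<noteq> 0" and t: "t > 0"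
  shows "\<exists>a. (\<forall>i. a i \<in> V) \<and>
    avg V (\<lambda>z. \<bar>(\<Sum>i<t\<^sup>2. f (z + a i) * f z / (real (t\<^sup>2) * avg V f)) - f z\<bar>) \<le> 1 / (real t * \<bar>avg V f\<bar>)"
proof -
  define b where "b = avg V f"
  define m where "m = t\<^sup>2"
  have m: "real m > 0" and b0: "b \<noteq> 0" using t assms(3) by (auto simp: m_def b_def)
  from sample_derivatives[where m=m and f=f, OF V f] obtain a where a: "\<forall>i. a i \<in> V"
    "avg V (\<lambda>z. (\<Sum>i<m. f (z + a i) * f z - b * f z)\<^sup>2) \<le> real m"
    unfolding b_def by blast
  define D where "D z = (\<Sum>i<m. f (z + a i) * f z / (real m * b)) - f z" for z
  have D: "D z = (\<Sum>i<m. f (z + a i) * f z - b * f z) * (1 / (real m * b))" for z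
    using m b0 by (simp add: D_def sum_subtractf sum_divide_distrib[symmetric] field_simps)
  have "(avg V (\<lambda>z. \<bar>D z\<bar>))\<^sup>2 \<le> avg V (\<lambda>z. (D z)\<^sup>2)"
    using avg_square[OF V, of "\<lambda>z. \<bar>D z\<bar>"] by simp
  also have "\<dots> = avg V (\<lambda>z. (\<Sum>i<m. f (z + a i) * f z - b * f z)\<^sup>2) * (1 / (real m * b))\<^sup>2"
    unfolding D power_mult_distrib avg_multc ..
  also have "\<dots> \<le> real m * (1 / (real m * b))\<^sup>2"
    by (rule mult_right_mono[OF a(2)]) simp
  also have "\<dots> = (1 / (real t * \<bar>b\<bar>))\<^sup>2"
    using t b0 by (simp add: m_def field_simps power2_eq_square)
  finally have "avg V (\<lambda>z. \<bar>D z\<bar>) \<le> 1 / (real t * \<bar>b\<bar>)"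
    by (rule power2_le_imp_le) simp
  then show ?thesis using a(1) unfolding D_def m_def b_def by blast
qed

text \<open>The average of sampled derivatives approximates \<open>f\<close> in \<open>L\<^sup>1\<close>. Inserting it in the identity
  \<open>f(x) = \<Prod>\<^sub>J f(x + h\<^sub>J)\<close>, whose vertices are uniformly distributed, gives an approximation valid at
  every \<open>x\<close>, made of cube averages of derivatives of \<open>f\<close>.\<close>

lemma bias_rank_Suc:
  assumes rk: "\<And>s. s \<le> r \<Longrightarrow> bias_rank TYPE(nat \<Rightarrow> 'a::ab_group_add) s"
  shows "bias_rank TYPE('a) (Suc r)"
  unfolding bias_rank_def
proof (intro allI impI)
  fix \<epsilon> :: real assume \<epsilon>: "\<epsilon> > 0"
  define M where "M = max 1 (1 / \<epsilon>)"
  have M: "M \<ge> 1" by (simp add: M_def)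
  define k where "k = Suc r"
  define N where "N = Pow {..<k} - {{}}"
  define n where "n = card N"
  have finN: "finite N" by (simp add: N_def)
  \<comment> \<open>Each of the n nonempty vertices contributes mean error at most M/t, and
    exchanging the product costs M^n; this t makes the total at most 1/4.\<close>
  obtain t0 :: nat where t0: "4 * (real n * M ^ n * M) \<le> real t0" using real_arch_simple by blast
  define t where "t = Suc t0"
  have t: "t > 0" "4 * (real n * M ^ n * M) \<le> real t" using t0 by (auto simp: t_def)
  define m where "m = t\<^sup>2"
  have m: "m > 0" using t by (simp add: m_def)
  \<comment> \<open>\<open>\<Phi>\<close> will be a sum of m^n cube averages with coefficients at
    most (M/m)^n, so changing each by \<open>\<eta>\<close> changes it by at most 1. With two errors
    of 1/4 this stays below 2.\<close>
  define \<eta> where "\<eta> = 1 / M ^ n"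
  have "\<eta> > 0" using M by (simp add: \<eta>_def)
  obtain L where L: "down_list k L" "set L = Pow {..<k}" using down_list_exists by blast
  have "cube_avg_det TYPE('a) k L r r" by (rule cube_avg_det_all[OF rk L(1)]) auto
  from cube_avg_detD[OF this \<open>\<eta> > 0\<close>] obtain C1 where C1: "\<And>(V::'a set) q. fin_subgroup V \<Longrightarrow>
      (\<forall>J\<in>Pow {..<k}. phase r V (q J)) \<Longrightarrow> (L \<noteq> [] \<longrightarrow> phase r V (q (hd L))) \<Longrightarrow>
      shifts_determine V C1 (Pow {..<k}) q \<eta> (cube_avg V k (Pow {..<k}) q)"
    unfolding L(2) by blast
  \<comment> \<open>Each of the m^n choices of samples needs C1 shifts, and each shift is used alone
    and followed by one of m sampled directions.\<close>
  define C where "C = m ^ n * C1 * (1 + m)"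
  show "\<exists>C. \<forall>(V::'a set) f. fin_subgroup V \<longrightarrow> phase (Suc r) V f \<longrightarrow> \<epsilon> \<le> \<bar>avg V f\<bar> \<longrightarrow> derivs_determine V C f"
  proof (intro exI[of _ C] allI impI)
    fix V :: "'a set" and f
    assume V: "fin_subgroup V" and f: "phase (Suc r) V f" and bias: "\<epsilon> \<le> \<bar>avg V f\<bar>"
    define b where "b = avg V f"
    have b: "b \<noteq> 0" "1 / \<bar>b\<bar> \<le> M"
      using bias \<epsilon> by (auto simp: b_def M_def le_max_iff_disj field_simps)
    have sq: "f x * f x = 1" if "x \<in> V" for x by (rule phase_sq[OF f that])
    define W where "W = power_group V {..k}"
    have W: "fin_subgroup W" unfolding W_def by (rule fin_subgroup_power_group[OF V]) simp
    have hV: "x + (\<Sum>j\<in>J. h j) \<in> V" if "x \<in> V" "h \<in> W" "J \<in> Pow {..<k}" for x h J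
      by (intro fin_subgroupD(3)[OF V that(1)] fin_subgroup_sum[OF V]) (use that in \<open>auto simp: W_def power_group_def\<close>)
    from sample_approximation[OF V sq b(1)[unfolded b_def] t(1)] obtain a where a: "\<And>i. a i \<in> V" and
      a': "avg V (\<lambda>z. \<bar>(\<Sum>i<m. f (z + a i) * f z / (real m * b)) - f z\<bar>) \<le> 1 / (real t * \<bar>b\<bar>)"
      unfolding b_def[symmetric] m_def[symmetric] by blast
    define F where "F z = (\<Sum>i<m. f (z + a i) * f z / (real m * b))" for z
    have FM: "\<bar>F z\<bar> \<le> M" if z: "z \<in> V" for z
    proof -
      have "\<bar>F z\<bar> \<le> (\<Sum>i<m. \<bar>f (z + a i) * f z / (real m * b)\<bar>)"
        unfolding F_def by (rule sum_abs)
      also have "\<dots> = (\<Sum>i<m. 1 / (real m * \<bar>b\<bar>))"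
        by (rule sum.cong) (simp_all add: abs_mult phase_abs[OF f] z fin_subgroupD(3)[OF V z a])
      also have "\<dots> = 1 / \<bar>b\<bar>" using m by simp
      finally show ?thesis using b(2) by linarith
    qed
    define \<Phi> where "\<Phi> x = avg W (\<lambda>h. \<Prod>J\<in>N. F (x + (\<Sum>j\<in>J. h j)))" for x
    have \<Phi>f: "\<bar>\<Phi> x - f x\<bar> \<le> 1 / 4" if x: "x \<in> V" for x
    proof -
      have self: "f x = (\<Prod>J\<in>N. f (x + (\<Sum>j\<in>J. h j)))" if h: "h \<in> W" for h
      proof -
        have "1 = (\<Prod>J\<in>Pow {..<k}. f (x + (\<Sum>j\<in>J. h j)))"
          using f by (subst phase_cube[OF V _ x]) (use h in \<open>auto simp: k_def W_def power_group_def\<close>)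
        also have "\<dots> = f x * (\<Prod>J\<in>N. f (x + (\<Sum>j\<in>J. h j)))"
          unfolding N_def by (subst prod.remove[of _ "{}"]) auto
        finally have "f x * 1 = f x * (f x * (\<Prod>J\<in>N. f (x + (\<Sum>j\<in>J. h j))))" by simp
        then show ?thesis using sq[OF x] by (simp flip: mult.assoc)
      qed
      have "avg W (\<lambda>h. \<Prod>J\<in>N. f (x + (\<Sum>j\<in>J. h j))) = avg W (\<lambda>h. f x)"
        by (rule avg_cong) (rule self[symmetric])
      then have "f x = avg W (\<lambda>h. \<Prod>J\<in>N. f (x + (\<Sum>j\<in>J. h j)))"
        by (simp only: avg_const[OF W])
      then have "\<bar>\<Phi> x - f x\<bar> = \<bar>avg W (\<lambda>h. (\<Prod>J\<in>N. F (x + (\<Sum>j\<in>J. h j))) - (\<Prod>J\<in>N. f (x + (\<Sum>j\<in>J. h j))))\<bar>"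
        unfolding \<Phi>_def avg_diff by simp
      also have "\<dots> \<le> avg W (\<lambda>h. \<bar>(\<Prod>J\<in>N. F (x + (\<Sum>j\<in>J. h j))) - (\<Prod>J\<in>N. f (x + (\<Sum>j\<in>J. h j)))\<bar>)"
        by (rule avg_abs)
      also have "\<dots> \<le> avg W (\<lambda>h. M ^ n * (\<Sum>J\<in>N. \<bar>F (x + (\<Sum>j\<in>J. h j)) - f (x + (\<Sum>j\<in>J. h j))\<bar>))"
      proof (rule avg_mono)
        fix h assume h: "h \<in> W"
        have *: "x + (\<Sum>j\<in>J. h j) \<in> V" if "J \<in> N" for J
          using hV[OF x h] that by (auto simp: N_def)
        show "\<bar>(\<Prod>J\<in>N. F (x + (\<Sum>j\<in>J. h j))) - (\<Prod>J\<in>N. f (x + (\<Sum>j\<in>J. h j)))\<bar>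
            \<le> M ^ n * (\<Sum>J\<in>N. \<bar>F (x + (\<Sum>j\<in>J. h j)) - f (x + (\<Sum>j\<in>J. h j))\<bar>)"
          unfolding n_def by (rule prod_diff_bound[OF M finN]) (simp_all add: FM * phase_abs[OF f])
      qed
      also have "\<dots> = M ^ n * (\<Sum>J\<in>N. avg V (\<lambda>z. \<bar>F z - f z\<bar>))"
        unfolding avg_cmult avg_sum W_def
        by (intro arg_cong[where f="\<lambda>u. M ^ n * u"] sum.cong avg_cube_vertex[OF V _ _ x, where g="\<lambda>z. \<bar>F z - f z\<bar>"])
           (auto simp: N_def)
      also have "\<dots> \<le> M ^ n * (real n * (M / real t))"
      proof -
        have "avg V (\<lambda>z. \<bar>F z - f z\<bar>) \<le> 1 / (real t * \<bar>b\<bar>)" using a' unfolding F_def .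
        also have "\<dots> \<le> M / real t" using b(2) t(1) by (simp add: field_simps)
        finally have "(\<Sum>J\<in>N. avg V (\<lambda>z. \<bar>F z - f z\<bar>)) \<le> real n * (M / real t)"
          unfolding n_def by (intro sum_bounded_above)
        then show ?thesis using M by (intro mult_left_mono) auto
      qed
      also have "\<dots> \<le> 1 / 4" using t by (simp add: field_simps)
      finally show ?thesis .
    qed
    define P where "P = N \<rightarrow>\<^sub>E {..<m}"
    have finP: "finite P" unfolding P_def by (rule finite_PiE[OF finN]) simp
    have cardP: "card P = m ^ n" unfolding P_def n_def by (simp add: card_funcsetE[OF finN])
    \<comment> \<open>\<open>\<alpha>\<close> picks one sample for each nonempty vertex. The base
      vertex gets the trivial phase, so that the family is indexed by all of
      \<open>Pow {..<k}\<close>.\<close>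
    define q where "q \<alpha> J x = (if J = {} then 1 else f (x + a (\<alpha> J)) * f x)" for \<alpha> :: "nat set \<Rightarrow> nat" and J x
    have \<Phi>: "\<Phi> x = (\<Sum>\<alpha>\<in>P. (1 / (real m * b)) ^ n * cube_avg V k (Pow {..<k}) (q \<alpha>) x)" for x
    proof -
      have "(\<Prod>J\<in>N. F (x + (\<Sum>j\<in>J. h j))) =
          (\<Sum>\<alpha>\<in>P. (1 / (real m * b)) ^ n * (\<Prod>J\<in>Pow {..<k}. q \<alpha> J (x + (\<Sum>j\<in>J. h j))))" for h
      proof -
        have "(\<Prod>J\<in>N. F (x + (\<Sum>j\<in>J. h j))) = (\<Sum>\<alpha>\<in>P. \<Prod>J\<in>N.
            f (x + (\<Sum>j\<in>J. h j) + a (\<alpha> J)) * f (x + (\<Sum>j\<in>J. h j)) / (real m * b))"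
          unfolding F_def P_def by (rule prod_sum_PiE[OF finN]) simp
        also have "\<dots> = (\<Sum>\<alpha>\<in>P. (1 / (real m * b)) ^ n * (\<Prod>J\<in>Pow {..<k}. q \<alpha> J (x + (\<Sum>j\<in>J. h j))))"
        proof (rule sum.cong, simp)
          fix \<alpha>
          have "(\<Prod>J\<in>N. f (x + (\<Sum>j\<in>J. h j) + a (\<alpha> J)) * f (x + (\<Sum>j\<in>J. h j)) / (real m * b)) =
             (\<Prod>J\<in>N. (1 / (real m * b)) * q \<alpha> J (x + (\<Sum>j\<in>J. h j)))"
            by (rule prod.cong) (auto simp: q_def N_def)
          also have "\<dots> = (1 / (real m * b)) ^ n * (\<Prod>J\<in>N. q \<alpha> J (x + (\<Sum>j\<in>J. h j)))"
            by (simp only: prod.distrib prod_constant n_def)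
          also have "(\<Prod>J\<in>N. q \<alpha> J (x + (\<Sum>j\<in>J. h j))) = (\<Prod>J\<in>Pow {..<k}. q \<alpha> J (x + (\<Sum>j\<in>J. h j)))"
            by (rule prod.mono_neutral_left) (auto simp: N_def q_def)
          finally show "(\<Prod>J\<in>N. f (x + (\<Sum>j\<in>J. h j) + a (\<alpha> J)) * f (x + (\<Sum>j\<in>J. h j)) / (real m * b)) =
              (1 / (real m * b)) ^ n * (\<Prod>J\<in>Pow {..<k}. q \<alpha> J (x + (\<Sum>j\<in>J. h j)))" .
        qed
        finally show ?thesis .
      qed
      then show ?thesis unfolding \<Phi>_def cube_avg_def W_def avg_sum[symmetric] avg_cmult[symmetric] by simp
    qed
    have phq: "phase r V (q \<alpha> J)" for \<alpha> J
    proof (cases "J = {}")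
      case True
      then show ?thesis using phase_one[OF V] by (simp add: q_def[abs_def])
    next
      case False
      then show ?thesis using phase_deriv[OF V a f] by (simp add: q_def[abs_def])
    qed
    have "shifts_determine V C1 (Pow {..<k}) (q \<alpha>) \<eta> (cube_avg V k (Pow {..<k}) (q \<alpha>))" for \<alpha>
      by (rule C1[OF V]) (use phq in auto)
    then have "\<exists>A. A \<subseteq> V \<and> card A \<le> C1 \<and> (\<forall>x\<in>V. \<forall>y\<in>V.
        (\<forall>J\<in>Pow {..<k}. \<forall>c\<in>A. q \<alpha> J (x + c) = q \<alpha> J (y + c)) \<longrightarrow>
        \<bar>cube_avg V k (Pow {..<k}) (q \<alpha>) x - cube_avg V k (Pow {..<k}) (q \<alpha>) y\<bar> \<le> \<eta>)" for \<alpha>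
      unfolding shifts_determine_def by simp
    then obtain AS where AS: "\<And>\<alpha>. AS \<alpha> \<subseteq> V \<and> card (AS \<alpha>) \<le> C1 \<and> (\<forall>x\<in>V. \<forall>y\<in>V.
        (\<forall>J\<in>Pow {..<k}. \<forall>c\<in>AS \<alpha>. q \<alpha> J (x + c) = q \<alpha> J (y + c)) \<longrightarrow>
        \<bar>cube_avg V k (Pow {..<k}) (q \<alpha>) x - cube_avg V k (Pow {..<k}) (q \<alpha>) y\<bar> \<le> \<eta>)"
      by metis
    define B where "B = (\<Union>\<alpha>\<in>P. AS \<alpha>)"
    define D where "D = insert 0 (a ` {..<m})"
    define A where "A = (\<lambda>(c, d). c + d) ` (B \<times> D)"
    have BV: "B \<subseteq> V" using AS by (auto simp: B_def)
    have DV: "D \<subseteq> V" using a fin_subgroupD(2)[OF V] by (auto simp: D_def)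
    have "A \<subseteq> V" using BV DV fin_subgroupD(3)[OF V] by (auto simp: A_def)
    have finB: "finite B" using BV fin_subgroupD(1)[OF V] by (rule finite_subset)
    have finD: "finite D" by (simp add: D_def)
    have "card B \<le> (\<Sum>\<alpha>\<in>P. card (AS \<alpha>))"
      unfolding B_def by (rule card_UN_le[OF finP])
    also have "\<dots> \<le> m ^ n * C1"
      using AS sum_bounded_above[of P "\<lambda>\<alpha>. card (AS \<alpha>)" C1] by (simp add: cardP)
    finally have cB: "card B \<le> m ^ n * C1" .
    have "card (a ` {..<m}) \<le> m" using card_image_le[of "{..<m}" a] by simp
    then have cD: "card D \<le> 1 + m"
      unfolding D_def using card_insert_le_m1[of "Suc m" "a ` {..<m}" 0] by simp
    have "card A \<le> card (B \<times> D)"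
      unfolding A_def by (rule card_image_le) (use finB finD in simp)
    also have "\<dots> \<le> C"
      unfolding C_def card_cartesian_product by (rule mult_le_mono[OF cB cD])
    finally have cA: "card A \<le> C" .
    show "derivs_determine V C f"
      unfolding derivs_determine_def
    proof (intro exI[of _ A] conjI ballI impI)
      fix x y assume x: "x \<in> V" and y: "y \<in> V" and eq: "\<forall>c\<in>A. f (x + c) * f x = f (y + c) * f y"
      \<comment> \<open>A derivative at the shifted point z + c is a product of two derivatives at
        z, in directions c + d and c; hence the 0 in \<open>D\<close>.\<close>
      have split: "f (z + c + d) * f (z + c) = (f (z + (c + d)) * f z) * (f (z + (c + 0)) * f z)" if "z \<in> V" for z c d
        using sq[OF that] by (simp add: add.assoc mult_ac)
      have qeq: "q \<alpha> J (x + c) = q \<alpha> J (y + c)" if "\<alpha> \<in> P" "J \<in> Pow {..<k}" "c \<in> AS \<alpha>" for \<alpha> J c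
      proof (cases "J = {}")
        case False
        then have "J \<in> N" using that by (auto simp: N_def)
        then have "\<alpha> J < m" using that(1) by (auto simp: P_def)
        then have "c + a (\<alpha> J) \<in> A" "c + 0 \<in> A"
          using that by (force simp: A_def B_def D_def)+
        then show ?thesis
          using eq False by (simp only: q_def split[OF x] split[OF y] if_False)
      qed (simp add: q_def)
      have coef: "\<bar>(1 / (real m * b)) ^ n\<bar> \<le> (M / real m) ^ n"
        unfolding power_abs using b m
        by (intro power_mono) (auto simp: abs_mult field_simps)
      have "\<bar>\<Phi> x - \<Phi> y\<bar> = \<bar>\<Sum>\<alpha>\<in>P. (1 / (real m * b)) ^ n *
          (cube_avg V k (Pow {..<k}) (q \<alpha>) x - cube_avg V k (Pow {..<k}) (q \<alpha>) y)\<bar>"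
        unfolding \<Phi> by (simp only: sum_subtractf right_diff_distrib)
      also have "\<dots> \<le> (\<Sum>\<alpha>\<in>P. \<bar>(1 / (real m * b)) ^ n *
          (cube_avg V k (Pow {..<k}) (q \<alpha>) x - cube_avg V k (Pow {..<k}) (q \<alpha>) y)\<bar>)"
        by (rule sum_abs)
      also have "\<dots> \<le> of_nat (card P) * ((M / real m) ^ n * \<eta>)"
      proof (rule sum_bounded_above)
        fix \<alpha> assume \<alpha>: "\<alpha> \<in> P"
        have "\<bar>cube_avg V k (Pow {..<k}) (q \<alpha>) x - cube_avg V k (Pow {..<k}) (q \<alpha>) y\<bar> \<le> \<eta>"
          by (rule conjunct2[OF conjunct2[OF AS], rule_format, OF x y]) (rule qeq[OF \<alpha>])
        then show "\<bar>(1 / (real m * b)) ^ n *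
            (cube_avg V k (Pow {..<k}) (q \<alpha>) x - cube_avg V k (Pow {..<k}) (q \<alpha>) y)\<bar> \<le> (M / real m) ^ n * \<eta>"
          unfolding abs_mult using coef M by (intro mult_mono) auto
      qed
      also have "\<dots> = 1"
        using m M by (simp add: cardP \<eta>_def power_divide)
      finally have "\<bar>\<Phi> x - \<Phi> y\<bar> \<le> 1" .
      then have "\<bar>f x - f y\<bar> < 2" using \<Phi>f[OF x] \<Phi>f[OF y] by linarith
      then show "f x = f y" using phase_pm[OF f x] phase_pm[OF f y] by auto
    qed (use \<open>A \<subseteq> V\<close> cA in simp_all)
  qed
qed

lemma bias_rank_all: "bias_rank TYPE(nat \<Rightarrow> 'c::ab_group_add) r"
proof (induction r rule: less_induct)
  case (less r)
  show ?case
  proof (cases r)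
    case 0
    show ?thesis unfolding bias_rank_def derivs_determine_def 0
      by (auto intro!: exI[of _ 0] exI[of _ "{}"])
  next
    case (Suc s)
    show ?thesis unfolding Suc
      by (rule bias_rank_Suc, rule bias_rank_powers, rule less) (simp add: Suc)
  qed
qed

section \<open>Densities avoid non-dyadic numbers\<close>

lemma dist_Ints_pos:
  fixes y :: real
  assumes "y \<notin> \<int>"
  shows "\<exists>\<delta>>0. \<forall>z\<in>\<int>. \<delta> \<le> \<bar>y - z\<bar>"
proof (intro exI[of _ "min (y - \<lfloor>y\<rfloor>) (\<lfloor>y\<rfloor> + 1 - y)"] conjI ballI)
  have "y \<noteq> real_of_int \<lfloor>y\<rfloor>" using assms by (metis Ints_of_int)
  then show "0 < min (y - \<lfloor>y\<rfloor>) (\<lfloor>y\<rfloor> + 1 - y)" by linarith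
next
  fix z :: real assume "z \<in> \<int>"
  then obtain i where i: "z = of_int i" by (auto elim: Ints_cases)
  show "min (y - \<lfloor>y\<rfloor>) (\<lfloor>y\<rfloor> + 1 - y) \<le> \<bar>y - z\<bar>"
  proof (cases "i \<le> \<lfloor>y\<rfloor>")
    case True
    then have "z \<le> real_of_int \<lfloor>y\<rfloor>" by (simp add: i)
    then show ?thesis by linarith
  next
    case False
    then have "\<lfloor>y\<rfloor> + 1 \<le> i" by simp
    then have "real_of_int (\<lfloor>y\<rfloor> + 1) \<le> z" unfolding i by (simp only: of_int_le_iff)
    then show ?thesis by simp
  qed
qed

text \<open>Up to small terms the mean of F is its constant coefficient, a multiple of 2^-m, unless
  some product of the phases is biased. Then one factor of that product can be recovered from the
  other factors and the derivatives of the product, and is traded for these. Bounding the list by M,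
  rather than fixing it, lets c depend on M and not on the group or the phases.\<close>

lemma density_gap:
  fixes \<rho> :: real and M :: "nat multiset"
  assumes \<rho>: "\<not> dyadic \<rho>"
  shows "\<exists>c>0. \<forall>(V::(nat \<Rightarrow> 'c::ab_group_add) set) F ps. fin_subgroup V \<longrightarrow> mset (map fst ps) \<subseteq># M \<longrightarrow>
    (\<forall>p\<in>set ps. phase (fst p) V (snd p)) \<longrightarrow> (\<forall>x\<in>V. F x \<in> {0, 1}) \<longrightarrow>
    (\<forall>x\<in>V. \<forall>y\<in>V. (\<forall>p\<in>set ps. snd p x = snd p y) \<longrightarrow> F x = F y) \<longrightarrow> c \<le> \<bar>avg V F - \<rho>\<bar>"
proof (induction M rule: wf_induct_rule[OF wf_mult[OF wf_less_than]])
  case (1 M)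
  define m where "m = size M"
  have "\<rho> * 2 ^ m \<notin> \<int>"
  proof
    assume "\<rho> * 2 ^ m \<in> \<int>"
    then obtain a where "\<rho> * 2 ^ m = of_int a" by (auto elim: Ints_cases)
    then have "\<rho> = of_int a / 2 ^ m" by (simp add: field_simps)
    then show False using \<rho> by (auto simp: dyadic_def)
  qed
  from dist_Ints_pos[OF this] obtain \<delta> where \<delta>: "\<delta> > 0" "\<And>z. z \<in> \<int> \<Longrightarrow> \<delta> \<le> \<bar>\<rho> * 2 ^ m - z\<bar>"
    by blast
  \<comment> \<open>At most 2^m products below this threshold contribute at most c0 together, while
    rho stays at least 2 * c0 away from the multiples of 2^-m.\<close>
  define \<epsilon> where "\<epsilon> = \<delta> / (2 * 2 ^ m * 2 ^ m)"
  have \<epsilon>: "\<epsilon> > 0" using \<delta>(1) by (simp add: \<epsilon>_def)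
  define c0 where "c0 = \<delta> / (2 * 2 ^ m)"
  have c0: "c0 > 0" using \<delta>(1) by (simp add: c0_def)
  \<comment> \<open>A trivial phase is constant, so no derivatives are needed for it. C = 0 at r = 0
    matters because there \<open>r - 1\<close> is not smaller than r.\<close>
  have "\<exists>C. (\<forall>(V::(nat \<Rightarrow> 'c) set) f. fin_subgroup V \<longrightarrow> phase r V f \<longrightarrow> \<epsilon> \<le> \<bar>avg V f\<bar> \<longrightarrow> derivs_determine V C f) \<and>
      (r = 0 \<longrightarrow> C = 0)" for r
  proof (cases "r = 0")
    case True
    have "derivs_determine V 0 f" if "phase 0 V f" for V :: "(nat \<Rightarrow> 'c) set" and f
      unfolding derivs_determine_def using that by (intro exI[of _ "{}"]) auto
    then show ?thesis using True by blast
  next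
    case False
    then show ?thesis using bias_rankD[OF bias_rank_all \<epsilon>, of r] by simp
  qed
  then obtain C where C: "\<And>r (V::(nat \<Rightarrow> 'c) set) f. fin_subgroup V \<Longrightarrow> phase r V f \<Longrightarrow> \<epsilon> \<le> \<bar>avg V f\<bar> \<Longrightarrow>
      derivs_determine V (C r) f" "C 0 = 0"
    by metis
  define M' where "M' r = M - {#r#} + replicate_mset (C r) (r - 1)" for r
  have M': "(M' r, M) \<in> mult less_than" if "r \<in># M" for r
  proof -
    have "r - 1 < r" if "C r \<noteq> 0" using that C(2) by (cases "r = 0") auto
    then have "(M - {#r#} + replicate_mset (C r) (r - 1), M - {#r#} + {#r#}) \<in> mult less_than"
      by (intro one_step_implies_mult) (auto simp: in_replicate_mset)
    then show ?thesis using that by (simp add: M'_def)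
  qed
  have "\<exists>c>0. \<forall>(V::(nat \<Rightarrow> 'c) set) F ps. fin_subgroup V \<longrightarrow> mset (map fst ps) \<subseteq># M' r \<longrightarrow>
    (\<forall>p\<in>set ps. phase (fst p) V (snd p)) \<longrightarrow> (\<forall>x\<in>V. F x \<in> {0, 1}) \<longrightarrow>
    (\<forall>x\<in>V. \<forall>y\<in>V. (\<forall>p\<in>set ps. snd p x = snd p y) \<longrightarrow> F x = F y) \<longrightarrow> c \<le> \<bar>avg V F - \<rho>\<bar>" if "r \<in># M" for r
    by (rule 1[OF M'[OF that]])
  then obtain c' where c': "\<And>r. r \<in># M \<Longrightarrow> c' r > 0 \<and> (\<forall>(V::(nat \<Rightarrow> 'c) set) F ps. fin_subgroup V \<longrightarrow>
    mset (map fst ps) \<subseteq># M' r \<longrightarrow> (\<forall>p\<in>set ps. phase (fst p) V (snd p)) \<longrightarrow> (\<forall>x\<in>V. F x \<in> {0, 1}) \<longrightarrow>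
    (\<forall>x\<in>V. \<forall>y\<in>V. (\<forall>p\<in>set ps. snd p x = snd p y) \<longrightarrow> F x = F y) \<longrightarrow> c' r \<le> \<bar>avg V F - \<rho>\<bar>)"
    by metis
  define c where "c = Min (insert c0 (c' ` set_mset M))"
  have c: "c > 0" "c \<le> c0" "\<And>r. r \<in># M \<Longrightarrow> c \<le> c' r"
    unfolding c_def using c0 c' by (auto simp: Min_gr_iff)
  show ?case
  proof (intro exI[of _ c] conjI allI impI c(1))
    fix V :: "(nat \<Rightarrow> 'c) set" and F :: "(nat \<Rightarrow> 'c) \<Rightarrow> real" and ps :: "(nat \<times> ((nat \<Rightarrow> 'c) \<Rightarrow> real)) list"
    assume V: "fin_subgroup V" and sub: "mset (map fst ps) \<subseteq># M"
      and ps: "\<forall>p\<in>set ps. phase (fst p) V (snd p)" and F: "\<forall>x\<in>V. F x \<in> {0, 1}"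
      and det: "\<forall>x\<in>V. \<forall>y\<in>V. (\<forall>p\<in>set ps. snd p x = snd p y) \<longrightarrow> F x = F y"
    define bias where "bias S = avg V (\<lambda>x. \<Prod>p\<in>S. snd p x)" for S :: "(nat \<times> ((nat \<Rightarrow> 'c) \<Rightarrow> real)) set"
    show "c \<le> \<bar>avg V F - \<rho>\<bar>"
    proof (cases "\<exists>S. S \<subseteq> set ps \<and> S \<noteq> {} \<and> \<epsilon> \<le> \<bar>bias S\<bar>")
      case False
      define l where "l = card (set ps)"
      have "l \<le> length ps" unfolding l_def by (rule card_length)
      also have "\<dots> = size (mset (map fst ps))" by simp
      also have "\<dots> \<le> m" unfolding m_def by (rule size_mset_mono[OF sub])
      finally have lm: "l \<le> m" .
      have "\<exists>\<gamma>. (\<forall>S. \<bar>\<gamma> S\<bar> \<le> 1 \<and> \<gamma> S * 2 ^ (0 + card (set ps)) \<in> \<int>) \<and>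
          (\<forall>x\<in>V. F x = (\<Sum>S\<in>Pow (set ps). \<gamma> S * (\<Prod>p\<in>S. snd p x)))"
      proof (rule sign_fourier[OF finite_set])
        show "snd p x = 1 \<or> snd p x = -1" if "p \<in> set ps" "x \<in> V" for p x
          using phase_pm[of "fst p" V "snd p" x] ps that by blast
        show "\<bar>F x\<bar> \<le> 1" "F x * 2 ^ 0 \<in> \<int>" if "x \<in> V" for x
          using F that by force+
        show "F x = F y" if "x \<in> V" "y \<in> V" "\<And>p. p \<in> set ps \<Longrightarrow> snd p x = snd p y" for x y
          using det that by blast
      qed
      then obtain \<gamma> where \<gamma>: "\<And>S. \<bar>\<gamma> S\<bar> \<le> 1" "\<gamma> {} * 2 ^ l \<in> \<int>"
        "\<And>x. x \<in> V \<Longrightarrow> F x = (\<Sum>S\<in>Pow (set ps). \<gamma> S * (\<Prod>p\<in>S. snd p x))"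
        unfolding l_def by auto
      have "avg V F = (\<Sum>S\<in>Pow (set ps). \<gamma> S * bias S)"
        unfolding bias_def avg_cmult[symmetric] avg_sum[symmetric] by (rule avg_cong) (rule \<gamma>(3))
      also have "\<dots> = \<gamma> {} * bias {} + (\<Sum>S\<in>Pow (set ps) - {{}}. \<gamma> S * bias S)"
        by (rule sum.remove) auto
      also have "bias {} = 1" by (simp add: bias_def avg_const[OF V])
      finally have "\<bar>avg V F - \<gamma> {}\<bar> = \<bar>\<Sum>S\<in>Pow (set ps) - {{}}. \<gamma> S * bias S\<bar>" by simp
      also have "\<dots> \<le> (\<Sum>S\<in>Pow (set ps) - {{}}. \<bar>\<gamma> S * bias S\<bar>)" by (rule sum_abs)
      also have "\<dots> \<le> of_nat (card (Pow (set ps) - {{}})) * \<epsilon>"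
      proof (rule sum_bounded_above)
        fix S assume "S \<in> Pow (set ps) - {{}}"
        then have "\<not> \<epsilon> \<le> \<bar>bias S\<bar>" using False by blast
        then have "\<bar>\<gamma> S\<bar> * \<bar>bias S\<bar> \<le> 1 * \<epsilon>"
          by (intro mult_mono \<gamma>(1)) linarith+
        then show "\<bar>\<gamma> S * bias S\<bar> \<le> \<epsilon>"
          by (simp only: abs_mult mult_1)
      qed
      also have "\<dots> \<le> 2 ^ m * \<epsilon>"
      proof (rule mult_right_mono)
        have "card (Pow (set ps) - {{}}) \<le> 2 ^ l"
          using card_mono[of "Pow (set ps)" "Pow (set ps) - {{}}"] by (auto simp: card_Pow l_def)
        also have "\<dots> \<le> 2 ^ m" using lm by (intro power_increasing) auto
        finally show "real (card (Pow (set ps) - {{}})) \<le> 2 ^ m"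
          by (metis of_nat_le_iff of_nat_numeral of_nat_power)
      qed (use \<epsilon> in simp)
      also have "\<dots> = c0" by (simp add: \<epsilon>_def c0_def)
      finally have near: "\<bar>avg V F - \<gamma> {}\<bar> \<le> c0" .
      have "\<gamma> {} * 2 ^ m = (\<gamma> {} * 2 ^ l) * 2 ^ (m - l)"
        using lm by (simp add: mult.assoc flip: power_add)
      also have "\<dots> \<in> \<int>" using \<gamma>(2) by simp
      finally have "\<delta> \<le> \<bar>\<rho> * 2 ^ m - \<gamma> {} * 2 ^ m\<bar>" by (rule \<delta>(2))
      also have "\<dots> = \<bar>\<rho> - \<gamma> {}\<bar> * 2 ^ m"
        by (simp add: abs_mult flip: left_diff_distrib)
      finally have "2 * c0 \<le> \<bar>\<rho> - \<gamma> {}\<bar>" by (simp add: c0_def field_simps)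
      then show ?thesis using near c(2) by linarith
    next
      case True
      then obtain S where S: "S \<subseteq> set ps" "S \<noteq> {}" "\<epsilon> \<le> \<bar>bias S\<bar>" by blast
      have finS: "finite S" using S(1) finite_subset by blast
      \<comment> \<open>The phase to be removed has the highest index r among the factors. Then Q
        has index r and its derivatives r - 1, so the multiset decreases.\<close>
      have "Max (fst ` S) \<in> fst ` S" using finS S(2) by (intro Max_in) auto
      then obtain p where p: "p \<in> S" "fst p = Max (fst ` S)" by auto
      define r where "r = fst p"
      have max: "fst p' \<le> r" if "p' \<in> S" for p'
        unfolding r_def p(2) using finS that by simp
      define Q where "Q x = (\<Prod>p\<in>S. snd p x)" for x
      have "phase r V Q"
        unfolding Q_def
      proof (rule phase_prod[OF V])
        fix p' assume p': "p' \<in> S"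
        then have "phase (fst p') V (snd p')" using ps S(1) by blast
        then show "phase r V (snd p')" using max[OF p'] by (rule phase_mono[OF V])
      qed
      have "derivs_determine V (C r) Q"
        using S(3) unfolding bias_def Q_def[symmetric] by (rule C(1)[OF V \<open>phase r V Q\<close>])
      then obtain A where A: "A \<subseteq> V" "card A \<le> C r" and
        Qdet: "\<forall>x\<in>V. \<forall>y\<in>V. (\<forall>a\<in>A. Q (x + a) * Q x = Q (y + a) * Q y) \<longrightarrow> Q x = Q y"
        unfolding derivs_determine_def by (elim exE conjE)
      have "finite A" using A(1) fin_subgroupD(1)[OF V] by (rule finite_subset)
      then obtain as where as: "set as = A" "distinct as" using finite_distinct_list by blast
      define ps' where "ps' = remove1 p ps @ map (\<lambda>a. (r - 1, \<lambda>x. Q (x + a) * Q x)) as"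
      have pps: "p \<in> set ps" using p(1) S(1) by auto
      have "r \<in># mset (map fst ps)" using pps by (auto simp: r_def)
      then have rM: "r \<in># M" by (rule mset_subset_eqD[OF sub])
      have "c' r \<le> \<bar>avg V F - \<rho>\<bar>"
      proof (rule conjunct2[OF c'[OF rM], rule_format, OF V])
        have "mset (map fst (remove1 p ps)) = mset (map fst ps) - {#r#}"
          using pps by (simp add: image_mset_Diff r_def)
        moreover have "mset (map fst ps) - {#r#} \<subseteq># M - {#r#}"
          using sub unfolding subseteq_mset_def count_diff by (blast intro: diff_le_mono)
        moreover have "mset (map fst (map (\<lambda>a. (r - 1, \<lambda>x. Q (x + a) * Q x)) as)) = replicate_mset (length as) (r - 1)"
          by (induction as) auto
        moreover have "replicate_mset (length as) (r - 1) \<subseteq># replicate_mset (C r) (r - 1)"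
          using A(2) as distinct_card[of as] by (simp add: subseteq_mset_def)
        ultimately show "mset (map fst ps') \<subseteq># M' r"
          unfolding ps'_def M'_def map_append mset_append
          by (simp only: subset_mset.add_mono)
      next
        fix p' assume "p' \<in> set ps'"
        then consider "p' \<in> set ps" | a where "a \<in> A" "p' = (r - 1, \<lambda>x. Q (x + a) * Q x)"
          unfolding ps'_def using as(1) set_remove1_subset[of p ps] by auto
        then show "phase (fst p') V (snd p')"
        proof cases
          case 1
          then show ?thesis using ps by blast
        next
          case 2
          then show ?thesis using phase_deriv[OF V _ \<open>phase r V Q\<close>, of a] A(1) by auto
        qed
      next
        fix x assume "x \<in> V"
        then show "F x \<in> {0, 1}" using F by blast
      next
        fix x y assume x: "x \<in> V" and y: "y \<in> V" and eq: "\<And>p'. p' \<in> set ps' \<Longrightarrow> snd p' x = snd p' y"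
        have eq1: "snd p' x = snd p' y" if "p' \<in> set ps" "p' \<noteq> p" for p'
          using that by (intro eq) (simp add: ps'_def in_set_remove1)
        have "Q (x + a) * Q x = Q (y + a) * Q y" if "a \<in> A" for a
          using eq[of "(r - 1, \<lambda>x. Q (x + a) * Q x)"] that as(1) by (auto simp: ps'_def)
        then have Qxy: "Q x = Q y" using Qdet x y by blast
        \<comment> \<open>The other factors of Q are still in the list; their product is nonzero and
          can be divided out of Q, which recovers p.\<close>
        define R where "R z = (\<Prod>p'\<in>S - {p}. snd p' z)" for z
        have QR: "Q z = snd p z * R z" for z
          unfolding Q_def R_def by (rule prod.remove[OF finS p(1)])
        have "R x = R y"
          unfolding R_def by (rule prod.cong) (use eq1 S(1) in auto)
        moreover have "R x \<noteq> 0"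
        proof -
          have "snd p' x \<noteq> 0" if "p' \<in> S" for p'
            using phase_abs[of "fst p'" V "snd p'" x] ps S(1) x that by force
          then show ?thesis unfolding R_def using finS by simp
        qed
        ultimately have "snd p x = snd p y" using Qxy QR[of x] QR[of y] by simp
        then have "\<forall>p'\<in>set ps. snd p' x = snd p' y" using eq1 by blast
        then show "F x = F y" using det x y by blast
      qed
      then show ?thesis using c(3)[OF rM] by linarith
    qed
  qed
qed

section \<open>Polynomials as phases\<close>

text \<open>The product rule over F_2: the derivative of v_i P(v) in direction a is v_i (P(v + a) +
  P(v)) + a_i P(v + a). The first summand falls under the induction hypothesis, the second has the
  degree of P.\<close>

lemma phase_restrict:
  assumes V: "fin_subgroup V"
  shows "phase k V f \<Longrightarrow> phase (Suc k) V (\<lambda>v :: nat \<Rightarrow> bit. if v i = 1 then f v else 1)"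
proof (induction k arbitrary: f)
  case 0
  then have "phase 0 V (\<lambda>v. if v i = 1 then f v else 1)" by simp
  then show ?case by (rule phase_Suc[OF V])
next
  case (Suc k)
  have "phase (Suc k) V (\<lambda>v. (if (v + a) i = 1 then f (v + a) else 1) * (if v i = 1 then f v else 1))"
    if a: "a \<in> V" for a
  proof -
    have "phase (Suc k) V (\<lambda>v. if v i = 1 then f (v + a) * f v else 1)"
      by (rule Suc.IH) (use phase_deriv[OF V a Suc.prems] in \<open>simp only: diff_Suc_1\<close>)
    moreover have "phase (Suc k) V (\<lambda>v. if a i = 1 then f (v + a) else 1)"
      by (cases "a i = 1") (simp_all only: if_True if_False simp_thms phase_shift[OF V a Suc.prems] phase_one[OF V])
    ultimately have "phase (Suc k) V (\<lambda>v. (if v i = 1 then f (v + a) * f v else 1) * (if a i = 1 then f (v + a) else 1))"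
      by (rule phase_mult[OF V])
    then show ?thesis
    proof (rule iffD1[OF phase_cong[OF V], rotated])
      fix v assume v: "v \<in> V"
      have "f (v + a) * f (v + a) = 1" by (rule phase_sq[OF Suc.prems fin_subgroupD(3)[OF V v a]])
      then show "(if v i = 1 then f (v + a) * f v else 1) * (if a i = 1 then f (v + a) else 1) =
          (if (v + a) i = 1 then f (v + a) else 1) * (if v i = 1 then f v else 1)"
        by (cases "v i"; cases "a i") (auto simp: mult_ac)
    qed
  qed
  moreover have "\<forall>x\<in>V. (if x i = 1 then f x else 1) = 1 \<or> (if x i = 1 then f x else 1) = -1"
    using phase_pm[OF Suc.prems] by auto
  ultimately show ?case by (subst phase.simps) blast
qed

lemma phase_monomial:
  assumes V: "fin_subgroup V" and "finite S"
  shows "phase (Suc (card S)) V (\<lambda>v :: nat \<Rightarrow> bit. if \<forall>i\<in>S. v i = 1 then -1 else 1)"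
  using assms(2)
proof (induction S rule: finite_induct)
  case (insert j S)
  have *: "(\<lambda>v. if \<forall>i\<in>insert j S. v i = 1 then -1 else 1) =
      (\<lambda>v. if v j = 1 then if \<forall>i\<in>S. v i = 1 then -1 else (1::real) else 1)"
    by auto
  show ?case
    unfolding * card_insert_disjoint[OF insert.hyps] by (rule phase_restrict[OF V insert.IH])
qed simp

lemma fin_subgroup_cube: "fin_subgroup (power_group (UNIV :: bit set) {..<n})"
proof (rule fin_subgroup_power_group)
  have "(UNIV :: bit set) = {0, 1}" using bit.exhaust by auto
  then have "finite (UNIV :: bit set)" by (metis finite.emptyI finite.insertI)
  then show "fin_subgroup (UNIV :: bit set)" by (simp add: fin_subgroup_def)
qed simp

lemma bij_betw_cube:
  "bij_betw (\<lambda>v. map (\<lambda>i. v i = (1::bit)) [0..<n]) (power_group UNIV {..<n}) (cube n)"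
proof (rule bij_betwI[where g="\<lambda>xs i. if i < n \<and> xs ! i then 1 else 0"])
  show "(\<lambda>xs i. if i < n \<and> xs ! i then 1 else 0) \<in> cube n \<rightarrow> power_group (UNIV :: bit set) {..<n}"
    by (auto simp: power_group_def)
  show "(\<lambda>i. if i < n \<and> map (\<lambda>i. v i = 1) [0..<n] ! i then 1 else 0) = v" if "v \<in> power_group (UNIV :: bit set) {..<n}" for v
    using that by (auto simp: power_group_def fun_eq_iff)
  show "map (\<lambda>i. (if i < n \<and> xs ! i then 1 else 0) = (1::bit)) [0..<n] = xs" if "xs \<in> cube n" for xs
    using that by (auto simp: cube_def intro!: nth_equalityI)
qed (auto simp: cube_def)

lemma poly_deg_le_phase:
  assumes "poly_deg_le n d P"
  shows "phase (Suc d) (power_group UNIV {..<n}) (\<lambda>v. if P (map (\<lambda>i. v i = (1::bit)) [0..<n]) then -1 else 1)"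
proof -
  define V where "V = power_group (UNIV :: bit set) {..<n}"
  have V: "fin_subgroup V" unfolding V_def by (rule fin_subgroup_cube)
  from assms obtain c where c: "\<And>x. x \<in> cube n \<Longrightarrow>
      P x = odd (card {S. S \<subseteq> {..<n} \<and> card S \<le> d \<and> c S \<and> (\<forall>i\<in>S. x ! i)})"
    unfolding poly_deg_le_def by blast
  define T where "T = {S. S \<subseteq> {..<n} \<and> card S \<le> d \<and> c S}"
  have finT: "finite T" by (rule finite_subset[of _ "Pow {..<n}"]) (auto simp: T_def)
  have "phase (Suc d) V (\<lambda>v. \<Prod>S\<in>T. if \<forall>i\<in>S. v i = 1 then -1 else 1)"
  proof (rule phase_prod[OF V])
    fix S assume "S \<in> T"
    then have "finite S" "Suc (card S) \<le> Suc d" by (auto simp: T_def intro: finite_subset)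
    then show "phase (Suc d) V (\<lambda>v. if \<forall>i\<in>S. v i = 1 then -1 else 1)"
      using phase_mono[OF V phase_monomial[OF V]] by blast
  qed
  then show ?thesis unfolding V_def[symmetric]
  proof (rule iffD1[OF phase_cong[OF V], rotated])
    fix v assume "v \<in> V"
    have "(\<Prod>S\<in>T. if \<forall>i\<in>S. v i = 1 then -1 else (1::real)) = (-1) ^ card {S\<in>T. \<forall>i\<in>S. v i = 1}"
      using finT by (simp add: prod.If_cases Int_def)
    also have "{S\<in>T. \<forall>i\<in>S. v i = 1} = {S. S \<subseteq> {..<n} \<and> card S \<le> d \<and> c S \<and>
        (\<forall>i\<in>S. map (\<lambda>i. v i = 1) [0..<n] ! i)}"
      by (auto simp: T_def subset_iff)
    also have "(-1::real) ^ card \<dots> = (if P (map (\<lambda>i. v i = 1) [0..<n]) then -1 else 1)"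
      by (subst c) (auto simp: cube_def)
    finally show "(\<Prod>S\<in>T. if \<forall>i\<in>S. v i = 1 then -1 else (1::real)) =
        (if P (map (\<lambda>i. v i = 1) [0..<n]) then -1 else 1)" .
  qed
qed

lemma avg_indicator_eq_prob_one:
  "avg (power_group UNIV {..<n}) (\<lambda>v. if P (map (\<lambda>i. v i = (1::bit)) [0..<n]) then 1 else 0) = prob_one n P"
proof -
  let ?g = "\<lambda>v. map (\<lambda>i. v i = (1::bit)) [0..<n]"
  have cube: "cube n = {xs. set xs \<subseteq> UNIV \<and> length xs = n}" by (auto simp: cube_def)
  have fin: "finite (cube n)" unfolding cube by (rule finite_lists_length_eq) simp
  have card: "card (cube n) = 2 ^ n" unfolding cube by (subst card_lists_length_eq) auto
  have "(\<Sum>v\<in>power_group UNIV {..<n}. if P (?g v) then 1 else 0) = (\<Sum>x\<in>cube n. if P x then 1 else (0::real))"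
    by (rule sum.reindex_bij_betw[OF bij_betw_cube])
  also have "\<dots> = real (card {x\<in>cube n. P x})"
    using fin by (simp add: sum.If_cases Int_def)
  finally show ?thesis
    using bij_betw_same_card[OF bij_betw_cube, of n] by (simp add: avg_def prob_one_def card)
qed

theorem theoremA8:
  fixes \<rho> :: real and d :: nat
  assumes "0 < \<rho>" and "\<rho> < 1" and "\<not> dyadic \<rho>" and "0 < d"
  shows "\<exists>c>0. \<forall>(n::nat) (P::bool list \<Rightarrow> bool). poly_deg_le n d P \<longrightarrow> tv_ber n P \<rho> \<ge> c"
proof -
  \<comment> \<open>A single phase, (-1)^P; its index is \<open>Suc d\<close> because indices exceed
    degrees by one.\<close>
  from density_gap[OF assms(3), of "{#Suc d#}"] obtain c where c: "c > 0"
    "\<And>(V::(nat \<Rightarrow> bit) set) F ps. fin_subgroup V \<Longrightarrow> mset (map fst ps) \<subseteq># {#Suc d#} \<Longrightarrow>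
    (\<forall>p\<in>set ps. phase (fst p) V (snd p)) \<Longrightarrow> (\<forall>x\<in>V. F x \<in> {0, 1}) \<Longrightarrow>
    (\<forall>x\<in>V. \<forall>y\<in>V. (\<forall>p\<in>set ps. snd p x = snd p y) \<longrightarrow> F x = F y) \<Longrightarrow> c \<le> \<bar>avg V F - \<rho>\<bar>"
    by blast
  show ?thesis
  proof (intro exI[of _ c] conjI allI impI c(1))
    fix n P assume P: "poly_deg_le n d P"
    let ?g = "\<lambda>v. map (\<lambda>i. v i = (1::bit)) [0..<n]"
    have "c \<le> \<bar>avg (power_group UNIV {..<n}) (\<lambda>v. if P (?g v) then 1 else 0) - \<rho>\<bar>"
      by (rule c(2)[OF fin_subgroup_cube, of "[(Suc d, \<lambda>v. if P (?g v) then -1 else 1)]"])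
         (use poly_deg_le_phase[OF P] in \<open>auto simp del: phase.simps split: if_splits\<close>)
    \<comment> \<open>The two outcomes contribute equally to the distance, which cancels the factor
      1/2.\<close>
    then show "c \<le> tv_ber n P \<rho>"
      unfolding avg_indicator_eq_prob_one tv_ber_def by simp
  qed
qed

end
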